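(* Let $G=(V,E)$ be a finite graph, let $\mathcal V$ be a height function potential with dual spin potential $\mathcal U$, let $\#\in\{\Diamond,\star\}$ and let $-\#$ denote the other element of $\{\Diamond,\star\}$. Then for all $\epsilon,\omega\in\Omega^1(\mathbb R)$, $$\nu_{\#}\big[(\mathbf n,\epsilon)(\mathbf n,\omega)\big]+\mu_{-\#}\big[(\mathcal U'(J),\epsilon)(\mathcal U'(J),\omega)\big]=\sum_{e\in E}\mu_{-\#}[\mathcal U''(J_e)]\,\epsilon_e\omega_e .$$
   Context: $\mathbb S=\{z\in\mathbb C:|z|=1\}$ is identified with $\mathbb R/2\pi\mathbb Z$ (angles in $(-\pi,\pi]$) and written additively. For $\mathbb G\in\{\mathbb R,\mathbb Z,\mathbb S\}$ let $\Omega^0(\mathbb G)=\mathbb G^V$, and let $\Omega^1(\mathbb G)$ be the group of 1-forms, i.e. antisymmetric functions $\omega$ on directed edges ($\omega_{xy}=-\omega_{yx}$) with values in $\mathbb G$; fixing one orientation of every edge identifies $\Omega^1(\mathbb G)$ with $\mathbb G^E$. Set $\mathrm d f_{xy}=f_y-f_x$ for $f\in\Omega^0(\mathbb G)$ and $\mathrm d^*\omega_x=\sum_{y\sim x}\omega_{yx}$ for $\omega\in\Omega^1(\mathbb G)$, and $H_\star(\mathbb G)=\mathrm{Im}(\mathrm d)$, $H_\Diamond(\mathbb G)=\ker(\mathrm d^* )$. The inner product on $\Omega^1(\mathbb R)$ is $(\epsilon,\omega)=\sum_{e\in E}\epsilon_e\omega_e$. Potentials: $\mathcal V:\mathbb Z\to\mathbb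 R\cup\{+\infty\}$ is a height function potential if $\mathcal V(n)=\mathcal V(-n)$, $\sum_{n\in\mathbb Z}n^2e^{-\mathcal V(n)}<\infty$, and $w(\alpha):=e^{-\mathcal V(0)}+\sum_{n\ge1}2e^{-\mathcal V(n)}\cos(n\alpha)>0$ for all $\alpha\in\mathbb R$. Its dual spin potential is $\mathcal U=-\log w$, an even, $2\pi$-periodic, twice continuously differentiable function. Since $\mathcal U'$ is odd, $\mathcal U'(J)=(\mathcal U'(J_e))_e$ is a real 1-form for $J\in\Omega^1(\mathbb S)$. Measures: for $\#\in\{\Diamond,\star\}$, $\mu_\#$ is the probability measure on $H_\#(\mathbb S)$ with $d\mu_\#(J)\propto\prod_{e\in E}w(J_e)\,dJ$, where $dJ$ is the Haar probability measure on the compact group $H_\#(\mathbb S)$; $\nu_\#$ is the probability measure on $H_\#(\mathbb Z)$ with $\nu_\#(\mathbf n)\propto\exp(-\sum_{e\in E}\mathcal V(\mathbf n_e))$. $\mu_\#[\cdot]$ and $\nu_\#[\cdot]$ also denote expectations. *)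

theory Defs
  imports "HOL-Probability.Probability" "Graph_Theory.Pair_Digraph"
begin

subsection \<open>The circle group\<close>

text \<open>
  The unit circle, written additively: addition in \<open>circle\<close> is multiplication of the
  underlying unit complex numbers, and the topology is the one inherited from the plane.
\<close>

typedef circle = "sphere (0::complex) 1"
  morphisms complex_of_circle circle_of_complex
  by (rule exI[of _ 1]) simp

setup_lifting type_definition_circle

instantiation circle :: ab_group_add
begin

lift_definition zero_circle :: circle is "1 :: complex"
  by simp

lift_definition plus_circle :: "circle \<Rightarrow> circle \<Rightarrow> circle" is "(*) :: complex \<Rightarrow> complex \<Rightarrow> complex"
  by (simp add: norm_mult)

lift_definition uminus_circle :: "circle \<Rightarrow> circle" is "inverse :: complex \<Rightarrow> complex"
  by (simp add: norm_inverse)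

lift_definition minus_circle :: "circle \<Rightarrow> circle \<Rightarrow> circle" is "(/) :: complex \<Rightarrow> complex \<Rightarrow> complex"
  by (simp add: norm_divide)

instance
proof
  fix a b c :: circle
  show "a + b + c = a + (b + c)" by transfer (simp add: mult.assoc)
  show "a + b = b + a" by transfer (simp add: mult.commute)
  show "0 + a = a" by transfer simp
  show "- a + a = 0" by transfer (auto intro!: left_inverse)
  show "a - b = a + - b" by transfer (simp add: divide_inverse)
qed

end

instantiation circle :: metric_space
begin

definition dist_circle :: "circle \<Rightarrow> circle \<Rightarrow> real"
  where "dist_circle x y = dist (complex_of_circle x) (complex_of_circle y)"

definition uniformity_circle :: "(circle \<times> circle) filter"
  where "uniformity_circle = (INF e\<in>{0<..}. principal {(x, y). dist x y < e})"

definition open_circle :: "circle set \<Rightarrow> bool"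
  where "open_circle U = (\<forall>x\<in>U. eventually (\<lambda>(x', y). x' = x \<longrightarrow> y \<in> U) uniformity)"

instance
proof
  fix x y z :: circle and U :: "circle set"
  show "dist x y = 0 \<longleftrightarrow> x = y"
    by (simp add: dist_circle_def complex_of_circle_inject)
  show "dist x y \<le> dist x z + dist y z"
    unfolding dist_circle_def by (rule dist_triangle2)
  show "uniformity = (INF e\<in>{0<..}. principal {(x::circle, y). dist x y < e})"
    by (rule uniformity_circle_def)
  show "open U = (\<forall>x\<in>U. \<forall>\<^sub>F (x', y) in uniformity. x' = x \<longrightarrow> y \<in> U)"
    by (rule open_circle_def)
qed

end

text \<open>The representative in \<open>(-\<pi>, \<pi>]\<close> of a point of the circle.\<close>

definition angle :: "circle \<Rightarrow> real"
  where "angle z = Arg (complex_of_circle z)"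


subsection \<open>Forms on a graph\<close>

text \<open>
  A finite simple graph is a \<open>pair_graph\<close>; \<open>parcs G\<close> is its symmetric set of directed edges.
  Functions on vertices and on directed edges are extensional, i.e. \<open>undefined\<close> outside
  \<open>pverts G\<close> and \<open>parcs G\<close>.
\<close>

definition zero_forms :: "'v pair_pre_digraph \<Rightarrow> ('v \<Rightarrow> 'g::ab_group_add) set"
  where "zero_forms G = (pverts G \<rightarrow>\<^sub>E UNIV)"

definition one_forms :: "'v pair_pre_digraph \<Rightarrow> ('v \<times> 'v \<Rightarrow> 'g::ab_group_add) set"
  where "one_forms G = {\<omega> \<in> parcs G \<rightarrow>\<^sub>E UNIV. \<forall>(x, y)\<in>parcs G. \<omega> (x, y) = - \<omega> (y, x)}"

definition grad :: "'v pair_pre_digraph \<Rightarrow> ('v \<Rightarrow> 'g::ab_group_add) \<Rightarrow> ('v \<times> 'v \<Rightarrow> 'g)"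
  where "grad G f = (\<lambda>(x, y)\<in>parcs G. f y - f x)"

definition codiff :: "'v pair_pre_digraph \<Rightarrow> ('v \<times> 'v \<Rightarrow> 'g::ab_group_add) \<Rightarrow> 'v \<Rightarrow> 'g"
  where "codiff G \<omega> = (\<lambda>x\<in>pverts G. \<Sum>y | (x, y) \<in> parcs G. \<omega> (y, x))"

datatype kind = Star | Diamond

fun opp :: "kind \<Rightarrow> kind"
  where
    "opp Star = Diamond"
  | "opp Diamond = Star"

fun H :: "kind \<Rightarrow> 'v pair_pre_digraph \<Rightarrow> ('v \<times> 'v \<Rightarrow> 'g::ab_group_add) set"
  where
    "H Star G = grad G ` zero_forms G"
  | "H Diamond G = {\<omega> \<in> one_forms G. codiff G \<omega> = (\<lambda>x\<in>pverts G. 0)}"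

text \<open>A choice of one of the two directions for every undirected edge.\<close>

definition orientation :: "'v pair_pre_digraph \<Rightarrow> ('v \<times> 'v) set \<Rightarrow> bool"
  where "orientation G E \<longleftrightarrow>
    E \<subseteq> parcs G \<and> (\<forall>(x, y)\<in>parcs G. (x, y) \<in> E \<longleftrightarrow> (y, x) \<notin> E)"

definition form_inner :: "('v \<times> 'v) set \<Rightarrow> ('v \<times> 'v \<Rightarrow> real) \<Rightarrow> ('v \<times> 'v \<Rightarrow> real) \<Rightarrow> real"
  where "form_inner E \<epsilon> \<omega> = (\<Sum>e\<in>E. \<epsilon> e * \<omega> e)"


subsection \<open>Potentials\<close>

text \<open>\<open>exp_neg v\<close> is $e^{-v}$ for \<open>v\<close> in $(-\infty, +\infty]$.\<close>

definition exp_neg :: "ereal \<Rightarrow> real"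
  where "exp_neg v = (if v = \<infinity> then 0 else exp (- real_of_ereal v))"

definition spin_weight :: "(int \<Rightarrow> ereal) \<Rightarrow> real \<Rightarrow> real"
  where "spin_weight V \<alpha> =
    exp_neg (V 0) + (\<Sum>k. 2 * exp_neg (V (int (Suc k))) * cos (real (Suc k) * \<alpha>))"

definition height_potential :: "(int \<Rightarrow> ereal) \<Rightarrow> bool"
  where "height_potential V \<longleftrightarrow>
    (\<forall>n. V n \<noteq> -\<infinity>) \<and> (\<forall>n. V n = V (- n)) \<and>
    (\<lambda>n. (real_of_int n)\<^sup>2 * exp_neg (V n)) summable_on UNIV \<and>
    (\<forall>\<alpha>. spin_weight V \<alpha> > 0)"

definition spin_potential :: "(int \<Rightarrow> ereal) \<Rightarrow> real \<Rightarrow> real"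
  where "spin_potential V \<alpha> = - ln (spin_weight V \<alpha>)"

text \<open>The real 1-form \<open>\<U>'(J)\<close>, where \<open>\<U>\<close> is the dual spin potential of \<open>V\<close>.\<close>

definition spin_force ::
    "'v pair_pre_digraph \<Rightarrow> (int \<Rightarrow> ereal) \<Rightarrow> ('v \<times> 'v \<Rightarrow> circle) \<Rightarrow> ('v \<times> 'v \<Rightarrow> real)"
  where "spin_force G V J = (\<lambda>e\<in>parcs G. deriv (spin_potential V) (angle (J e)))"


subsection \<open>Measures\<close>

text \<open>
  \<open>A\<close> is meant to be a compact subgroup of the finite power of the circle indexed by \<open>parcs G\<close>.
  The circle is second countable and \<open>parcs G\<close> is finite, so the trace on \<open>A\<close> of the product
  of the Borel sigma-algebras is the Borel sigma-algebra of \<open>A\<close>.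
\<close>

definition is_haar_prob ::
    "'v pair_pre_digraph \<Rightarrow> ('v \<times> 'v \<Rightarrow> circle) set \<Rightarrow> ('v \<times> 'v \<Rightarrow> circle) measure \<Rightarrow> bool"
  where "is_haar_prob G A M \<longleftrightarrow>
    prob_space M \<and>
    space M = A \<and>
    sets M = sets (restrict_space (\<Pi>\<^sub>M e\<in>parcs G. borel) A) \<and>
    (\<forall>K\<in>A. distr M M (\<lambda>J. \<lambda>e\<in>parcs G. J e + K e) = M)"

definition haar_prob ::
    "'v pair_pre_digraph \<Rightarrow> ('v \<times> 'v \<Rightarrow> circle) set \<Rightarrow> ('v \<times> 'v \<Rightarrow> circle) measure"
  where "haar_prob G A = (THE M. is_haar_prob G A M)"

text \<open>
  \<open>prob_density M f\<close> has density proportional to the nonnegative function \<open>f\<close> with respect to \<open>M\<close>.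
\<close>

definition prob_density :: "'a measure \<Rightarrow> ('a \<Rightarrow> real) \<Rightarrow> 'a measure"
  where "prob_density M f = density M (\<lambda>x. ennreal (f x / (\<integral>y. f y \<partial>M)))"

definition spin_measure ::
    "'v pair_pre_digraph \<Rightarrow> ('v \<times> 'v) set \<Rightarrow> (int \<Rightarrow> ereal) \<Rightarrow> kind \<Rightarrow> ('v \<times> 'v \<Rightarrow> circle) measure"
  where "spin_measure G E V k =
    prob_density (haar_prob G (H k G)) (\<lambda>J. \<Prod>e\<in>E. spin_weight V (angle (J e)))"

definition height_measure ::
    "'v pair_pre_digraph \<Rightarrow> ('v \<times> 'v) set \<Rightarrow> (int \<Rightarrow> ereal) \<Rightarrow> kind \<Rightarrow> ('v \<times> 'v \<Rightarrow> int) measure"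
  where "height_measure G E V k =
    prob_density (count_space (H k G)) (\<lambda>n. exp_neg (\<Sum>e\<in>E. V (n e)))"

end

theory Submission
  imports Defs
begin

text \<open>
  Both groups \<open>H k\<close> of circle-valued forms are images of a torus under an integer matrix, so their Haar
  measure is the image of the product of uniform measures, and the integral of the character
  $\prod_e J_e^{n_e}$ over one of them is 1 or 0 according to whether the integer form \<open>n\<close> belongs to the
  other one. Expanding every factor of a product over the edges in a Fourier series therefore turns
  an integral over \<open>H (opp k)\<close> into a sum over \<open>H k\<close>. Since $w\,\mathcal U' = -w'$ and
  $w(\mathcal U'^2 - \mathcal U'') = w''$, the products
  $\mathcal U'(J_e)\,\mathcal U'(J_{e'}) - \delta_{ee'}\,\mathcal U''(J_e)$ times the weight are again
  products of \<open>w\<close>, \<open>w'\<close> and \<open>w''\<close>, whose Fourier expansions carry the additional factor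
  $(i n_e)(i n_{e'}) = - n_e n_{e'}$.
\<close>

subsection \<open>The circle\<close>

text \<open>The kernel of an integer matrix on a torus can be disconnected, and then it is not the
  image of a torus. That \<open>H Diamond G\<close> is such an image is therefore the
  graph-theoretic obstacle: it takes integer generators of the cycles that work over the circle and
  that also detect, by orthogonality, which integer forms are gradients. For \<open>H Star G\<close>
  the incidence matrix plays both roles almost by definition. Two derivatives may fall on the same
  edge, so the expansions need summable second moments of the coefficients; every other edge factor
  costs less. The expansion without derivatives shows that both models have the same partition
  function, which is why the two normalised expectations can be added.\<close>

lemma complex_of_circle_simps [simp]:
  "norm (complex_of_circle z) = 1"
  "complex_of_circle z \<noteq> 0"
  "complex_of_circle 0 = 1"
  "complex_of_circle (x + y) = complex_of_circle x * complex_of_circle y"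
  "complex_of_circle (- x) = inverse (complex_of_circle x)"
  using complex_of_circle[of z]
  by (auto simp: zero_circle.rep_eq plus_circle.rep_eq uminus_circle.rep_eq)

lemma complex_of_circle_sum:
  "complex_of_circle (\<Sum>i\<in>I. f i) = (\<Prod>i\<in>I. complex_of_circle (f i))"
  by (induction I rule: infinite_finite_induct) auto

lemma complex_of_circle_eq_cis_angle: "complex_of_circle z = cis (angle z)"
  unfolding angle_def using cis_Arg[of "complex_of_circle z"] by (simp add: sgn_eq)

lemma borel_measurable_complex_of_circle [measurable]: "complex_of_circle \<in> borel_measurable borel"
  by (rule borel_measurable_continuous_onI) (auto simp: continuous_on_iff dist_circle_def)

text \<open>The metric is pulled back from the plane, so the topology is the initial one for
  \<open>complex_of_circle\<close>. Measurability of circle-valued maps can hence be tested in the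
  plane.\<close>

lemma open_circle_vimage:
  assumes "open (S :: circle set)"
  shows "\<exists>T. open T \<and> S = complex_of_circle -` T"
proof -
  define T where "T = \<Union>{ball (complex_of_circle x) e | x e. ball x e \<subseteq> S}"
  have "open T" unfolding T_def by auto
  moreover have "S = complex_of_circle -` T"
  proof
    show "S \<subseteq> complex_of_circle -` T"
    proof
      fix x assume "x \<in> S"
      then obtain e where "e > 0" "ball x e \<subseteq> S" using assms open_contains_ball by metis
      then show "x \<in> complex_of_circle -` T"
        unfolding T_def by (auto intro!: exI[of _ "ball (complex_of_circle x) e"])
    qed
    show "complex_of_circle -` T \<subseteq> S"
      unfolding T_def by (auto simp: subset_iff dist_circle_def)
  qed
  ultimately show ?thesis by blast
qed

lemma measurable_circleI:
  assumes "(\<lambda>x. complex_of_circle (f x)) \<in> borel_measurable M"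
  shows "f \<in> borel_measurable M"
proof (rule borel_measurableI)
  fix S :: "circle set" assume "open S"
  then obtain T where T: "open T" "S = complex_of_circle -` T" using open_circle_vimage by blast
  then have "f -` S \<inter> space M = (\<lambda>x. complex_of_circle (f x)) -` T \<inter> space M" by auto
  then show "f -` S \<inter> space M \<in> sets M" using measurable_sets[OF assms, of T] T by auto
qed

lemma borel_measurable_circle_plus [measurable (raw)]:
  fixes f g :: "'a \<Rightarrow> circle"
  assumes [measurable]: "f \<in> borel_measurable M" "g \<in> borel_measurable M"
  shows "(\<lambda>x. f x + g x) \<in> borel_measurable M"
  by (rule measurable_circleI) (simp, measurable)

section \<open>Integer multiples in the circle group\<close>

text \<open>In the additive notation this is multiplication by an integer; it is what lets integer
  matrices act on tuples of circle points.\<close>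

lift_definition cpow :: "int \<Rightarrow> circle \<Rightarrow> circle" is "\<lambda>m z. z powi m"
  by (simp add: norm_power_int)

lemma cpow_simps [simp]: "cpow 0 z = 0" "cpow 1 z = z" "cpow m 0 = 0"
  by (transfer, simp)+

lemma cpow_add_left: "cpow (m + n) z = cpow m z + cpow n z"
  by transfer (subst power_int_add, auto)

lemma cpow_minus_left: "cpow (- m) z = - cpow m z"
  by transfer (auto simp: power_int_minus)

lemma cpow_diff_left: "cpow (m - n) z = cpow m z - cpow n z"
  using cpow_add_left[of m "- n" z] by (simp add: cpow_minus_left)

lemma cpow_add_right: "cpow m (z + w) = cpow m z + cpow m w"
  by transfer (auto simp: power_int_mult_distrib)

lemma cpow_sum_left: "cpow (\<Sum>i\<in>I. f i) z = (\<Sum>i\<in>I. cpow (f i) z)"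
  by (induction I rule: infinite_finite_induct) (auto simp: cpow_add_left)

lemma cpow_sum_right: "cpow m (\<Sum>i\<in>I. f i) = (\<Sum>i\<in>I. cpow m (f i))"
  by (induction I rule: infinite_finite_induct) (auto simp: cpow_add_right)

lemma complex_of_circle_cpow: "complex_of_circle (cpow m z) = complex_of_circle z powi m"
  by (rule cpow.rep_eq)

lemma borel_measurable_power_int [measurable (raw)]:
  fixes f :: "'a \<Rightarrow> complex"
  assumes [measurable]: "f \<in> borel_measurable M"
  shows "(\<lambda>x. f x powi m) \<in> borel_measurable M"
  unfolding power_int_def by (cases "m \<ge> 0") simp_all

lemma borel_measurable_cpow [measurable (raw)]:
  assumes [measurable]: "f \<in> borel_measurable M"
  shows "(\<lambda>x. cpow m (f x)) \<in> borel_measurable M"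
  by (rule measurable_circleI) (simp add: complex_of_circle_cpow)

lemma borel_measurable_circle_sum [measurable (raw)]:
  fixes f :: "'i \<Rightarrow> 'a \<Rightarrow> circle"
  assumes [measurable]: "\<And>i. i \<in> I \<Longrightarrow> f i \<in> borel_measurable M"
  shows "(\<lambda>x. \<Sum>i\<in>I. f i x) \<in> borel_measurable M"
  by (rule measurable_circleI) (simp add: complex_of_circle_sum)

section \<open>The uniform probability measure on the circle\<close>

text \<open>Parametrised with period 1, so that Lebesgue measure on \<open>{0..<1}\<close> is
  already a probability measure.\<close>

definition ecirc :: "real \<Rightarrow> circle"
  where "ecirc x = circle_of_complex (cis (2 * pi * x))"

lemma complex_of_ecirc [simp]: "complex_of_circle (ecirc x) = cis (2 * pi * x)"
  unfolding ecirc_def by (rule circle_of_complex_inverse) simp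

lemma circle_eqI: "complex_of_circle x = complex_of_circle y \<Longrightarrow> x = y"
  by (simp add: complex_of_circle_inject)

lemma ecirc_add: "ecirc (x + y) = ecirc x + ecirc y"
  by (rule circle_eqI) (simp add: cis_mult ring_distribs)

lemma ecirc_1 [simp]: "ecirc 1 = 0"
  by (rule circle_eqI) simp

lemma ecirc_surj: "\<exists>s\<in>{0..<1}. ecirc s = z"
proof
  define s where "s = Arg2pi (complex_of_circle z) / (2 * pi)"
  show "s \<in> {0..<1}"
    using Arg2pi_ge_0[of "complex_of_circle z"] Arg2pi_lt_2pi[of "complex_of_circle z"] by (auto simp: s_def)
  show "ecirc s = z"
    using Arg2pi_eq[of "complex_of_circle z"]
    by (intro circle_eqI) (simp add: s_def cis_conv_exp mult.commute)
qed

lemma borel_measurable_ecirc [measurable]: "ecirc \<in> borel_measurable borel"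
proof (rule measurable_circleI)
  have "continuous_on UNIV (\<lambda>x. cis (2 * pi * x))" by (intro continuous_intros)
  then show "(\<lambda>x. complex_of_circle (ecirc x)) \<in> borel_measurable borel"
    by (simp add: borel_measurable_continuous_onI)
qed

definition unif_circle :: "circle measure"
  where "unif_circle = distr (restrict_space lborel {0..<1}) borel ecirc"

lemma sets_unif_circle [simp, measurable_cong]: "sets unif_circle = sets borel"
  and space_unif_circle [simp]: "space unif_circle = UNIV"
  by (auto simp: unif_circle_def)

lemma emeasure_unif_circle:
  assumes "B \<in> sets borel"
  shows "emeasure unif_circle B = emeasure lborel {x \<in> {0..<1}. ecirc x \<in> B}"
proof -
  have "emeasure unif_circle B = emeasure (restrict_space lborel {0..<1}) (ecirc -` B \<inter> {0..<1})"
    unfolding unif_circle_def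
    by (subst emeasure_distr) (auto simp: assms space_restrict_space intro!: measurable_restrict_space1)
  also have "\<dots> = emeasure lborel (ecirc -` B \<inter> {0..<1})"
    by (subst emeasure_restrict_space) auto
  also have "ecirc -` B \<inter> {0..<1} = {x \<in> {0..<1}. ecirc x \<in> B}" by auto
  finally show ?thesis .
qed

lemma prob_space_unif_circle: "prob_space unif_circle"
proof (rule prob_spaceI)
  have "emeasure unif_circle UNIV = emeasure lborel {x \<in> {0..<1}. ecirc x \<in> UNIV}"
    by (rule emeasure_unif_circle) simp
  also have "{x \<in> {0..<1}. ecirc x \<in> UNIV} = {0..<1}" by auto
  finally show "emeasure unif_circle (space unif_circle) = 1" by simp
qed

lemma emeasure_lborel_translate:
  fixes s :: real
  assumes [measurable]: "X \<in> sets borel"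
  shows "emeasure lborel {x. s + x \<in> X} = emeasure lborel X"
proof -
  have "emeasure lborel X = emeasure (distr lborel borel ((+) s)) X"
    by (simp add: lborel_distr_plus)
  also have "\<dots> = emeasure lborel {x. s + x \<in> X}"
    by (subst emeasure_distr) (auto simp: vimage_def)
  finally show ?thesis by simp
qed

text \<open>With \<open>w = ecirc s\<close>, translation replaces the parameter interval by
  \<open>{s..<1 + s}\<close>. Cutting it at 1 and moving the piece beyond 1 back by one period
  restores \<open>{0..<1}\<close>.\<close>

lemma distr_unif_circle_plus: "distr unif_circle borel (\<lambda>z. z + w) = unif_circle"
proof (rule measure_eqI)
  fix B assume "B \<in> sets (distr unif_circle borel (\<lambda>z. z + w))"
  then have B [measurable]: "B \<in> sets borel" by simp
  obtain s where s: "s \<in> {0..<1}" "ecirc s = w" using ecirc_surj by blast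
  have ecirc_1_plus: "ecirc (1 + x) = ecirc x" for x by (simp add: ecirc_add)
  have 1 [measurable]: "{x. a \<le> x \<and> x < b \<and> ecirc x \<in> B} \<in> sets borel" for a b by measurable
  have "emeasure (distr unif_circle borel (\<lambda>z. z + w)) B = emeasure unif_circle {z. z + w \<in> B}"
    by (subst emeasure_distr) (auto simp: vimage_def)
  also have "\<dots> = emeasure lborel {x. s + x \<in> {y. s \<le> y \<and> y < 1 + s \<and> ecirc y \<in> B}}"
    by (subst emeasure_unif_circle, measurable)
       (auto simp: s(2)[symmetric] ecirc_add algebra_simps intro!: arg_cong[where f = "emeasure lborel"])
  also have "\<dots> = emeasure lborel {y. s \<le> y \<and> y < 1 + s \<and> ecirc y \<in> B}"
    by (rule emeasure_lborel_translate) measurable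
  also have "{y. s \<le> y \<and> y < 1 + s \<and> ecirc y \<in> B} =
      {y. s \<le> y \<and> y < 1 \<and> ecirc y \<in> B} \<union> {y. 1 \<le> y \<and> y < 1 + s \<and> ecirc y \<in> B}"
    using s by auto
  also have "emeasure lborel \<dots> = emeasure lborel {y. s \<le> y \<and> y < 1 \<and> ecirc y \<in> B} +
      emeasure lborel {y. 1 \<le> y \<and> y < 1 + s \<and> ecirc y \<in> B}"
    by (rule plus_emeasure[symmetric]) auto
  also have "emeasure lborel {y. 1 \<le> y \<and> y < 1 + s \<and> ecirc y \<in> B} =
      emeasure lborel {x. 1 + x \<in> {y. 1 \<le> y \<and> y < 1 + s \<and> ecirc y \<in> B}}"
    by (rule emeasure_lborel_translate[symmetric]) measurable
  also have "{x. 1 + x \<in> {y. 1 \<le> y \<and> y < 1 + s \<and> ecirc y \<in> B}} = {y. 0 \<le> y \<and> y < s \<and> ecirc y \<in> B}"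
    by (auto simp: ecirc_1_plus)
  also have "emeasure lborel {y. s \<le> y \<and> y < 1 \<and> ecirc y \<in> B} + emeasure lborel {y. 0 \<le> y \<and> y < s \<and> ecirc y \<in> B}
     = emeasure lborel ({y. s \<le> y \<and> y < 1 \<and> ecirc y \<in> B} \<union> {y. 0 \<le> y \<and> y < s \<and> ecirc y \<in> B})"
    by (rule plus_emeasure) auto
  also have "{y. s \<le> y \<and> y < 1 \<and> ecirc y \<in> B} \<union> {y. 0 \<le> y \<and> y < s \<and> ecirc y \<in> B} = {x \<in> {0..<1}. ecirc x \<in> B}"
    using s by auto
  also have "emeasure lborel \<dots> = emeasure unif_circle B" by (simp add: emeasure_unif_circle)
  finally show "emeasure (distr unif_circle borel (\<lambda>z. z + w)) B = emeasure unif_circle B" .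
qed simp

lemma integrable_unif_circle_powi: "integrable unif_circle (\<lambda>z. complex_of_circle z powi m)"
proof -
  interpret prob_space unif_circle by (rule prob_space_unif_circle)
  show ?thesis by (rule integrable_const_bound[of _ 1]) (auto simp: norm_power_int)
qed

lemma integral_unif_circle_powi:
  "(\<integral>z. complex_of_circle z powi m \<partial>unif_circle) = (if m = 0 then 1 else 0)"
proof (cases "m = 0")
  case True
  interpret prob_space unif_circle by (rule prob_space_unif_circle)
  show ?thesis using True prob_space by simp
next
  case False
  \<comment> \<open>This is the point of angle \<open>pi / m\<close>; translating by it flips the
    sign of the integrand, so invariance forces the integral to vanish.\<close>
  define w where "w = ecirc (1 / (2 * of_int m))"
  have w: "complex_of_circle w powi m = - 1"
    using False by (simp add: w_def cis_power_int)
  have "(\<integral>z. complex_of_circle z powi m \<partial>unif_circle) =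
      (\<integral>z. complex_of_circle z powi m \<partial>distr unif_circle borel (\<lambda>z. z + w))"
    by (simp add: distr_unif_circle_plus)
  also have "\<dots> = (\<integral>z. - (complex_of_circle z powi m) \<partial>unif_circle)"
    by (subst integral_distr) (auto simp: power_int_mult_distrib w)
  also have "\<dots> = - (\<integral>z. complex_of_circle z powi m \<partial>unif_circle)" by simp
  finally show ?thesis using False by (simp add: equal_neg_zero)
qed

subsection \<open>Haar measure on images of tori\<close>

text \<open>\<open>haar_prob\<close> is a definite description, so a concrete Haar measure can be
  substituted for it only once uniqueness is known.\<close>

lemma is_haar_prob_unique:
  assumes A: "\<And>J K. J \<in> A \<Longrightarrow> K \<in> A \<Longrightarrow> (\<lambda>e\<in>parcs G. J e + K e) \<in> A"
    and M: "is_haar_prob G A M" and N: "is_haar_prob G A N"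
  shows "M = N"
proof (rule measure_eqI)
  let ?R = "restrict_space (\<Pi>\<^sub>M e\<in>parcs G. borel) A :: ('a \<times> 'a \<Rightarrow> circle) measure"
  have sM [measurable_cong]: "sets M = sets ?R" and sN [measurable_cong]: "sets N = sets ?R"
    and sp: "space M = A" "space N = A"
    and iM: "\<And>K. K \<in> A \<Longrightarrow> distr M M (\<lambda>J. \<lambda>e\<in>parcs G. J e + K e) = M"
    and iN: "\<And>K. K \<in> A \<Longrightarrow> distr N N (\<lambda>J. \<lambda>e\<in>parcs G. J e + K e) = N"
    using M N by (auto simp: is_haar_prob_def)
  show sMN: "sets M = sets N" by (simp add: sM sN)
  interpret M: prob_space M using M by (simp add: is_haar_prob_def)
  interpret N: prob_space N using N by (simp add: is_haar_prob_def)
  interpret P: pair_sigma_finite M N ..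
  have comp: "(\<lambda>J. J e) \<in> borel_measurable ?R" if "e \<in> parcs G" for e
    using that by (intro measurable_restrict_space1 measurable_component_singleton)
  have add: "(\<lambda>x. \<lambda>e\<in>parcs G. fst x e + snd x e) \<in> M \<Otimes>\<^sub>M N \<rightarrow>\<^sub>M ?R"
  proof (rule measurable_restrict_space2)
    show "(\<lambda>x. \<lambda>e\<in>parcs G. fst x e + snd x e) \<in> space (M \<Otimes>\<^sub>M N) \<rightarrow> A"
      by (auto simp: space_pair_measure sp intro: A)
    show "(\<lambda>x. \<lambda>e\<in>parcs G. fst x e + snd x e) \<in> M \<Otimes>\<^sub>M N \<rightarrow>\<^sub>M (\<Pi>\<^sub>M e\<in>parcs G. borel)"
    proof (rule measurable_restrict)
      fix e assume "e \<in> parcs G"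
      note [measurable] = comp[OF this]
      show "(\<lambda>x. fst x e + snd x e) \<in> borel_measurable (M \<Otimes>\<^sub>M N)" by measurable
    qed
  qed
  fix B assume B: "B \<in> sets M"
  then have BR [measurable]: "B \<in> sets ?R" by (simp add: sM)
  have [measurable]: "(\<lambda>x. indicator B (\<lambda>e\<in>parcs G. fst x e + snd x e) :: ennreal) \<in> borel_measurable (M \<Otimes>\<^sub>M N)"
    by (rule measurable_compose[OF add borel_measurable_indicator[OF BR]])
  have shift: "(\<lambda>J. \<lambda>e\<in>parcs G. J e + K e) \<in> ?R \<rightarrow>\<^sub>M ?R" if "K \<in> A" for K
  proof (rule measurable_restrict_space2)
    show "(\<lambda>J. \<lambda>e\<in>parcs G. J e + K e) \<in> space ?R \<rightarrow> A"
      using that by (auto simp: space_restrict_space intro: A)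
    show "(\<lambda>J. \<lambda>e\<in>parcs G. J e + K e) \<in> ?R \<rightarrow>\<^sub>M (\<Pi>\<^sub>M e\<in>parcs G. borel)"
    proof (rule measurable_restrict)
      fix e assume "e \<in> parcs G"
      note [measurable] = comp[OF this]
      show "(\<lambda>J. J e + K e) \<in> borel_measurable ?R" by measurable
    qed
  qed
  have inner: "(\<integral>\<^sup>+J. indicator B (\<lambda>e\<in>parcs G. J e + K e) \<partial>L) = emeasure L B"
    if K: "K \<in> A" and L: "sets L = sets ?R" "distr L L (\<lambda>J. \<lambda>e\<in>parcs G. J e + K e) = L" for K L
  proof -
    have m: "(\<lambda>J. \<lambda>e\<in>parcs G. J e + K e) \<in> L \<rightarrow>\<^sub>M L"
      using shift[OF K] L(1) by (simp cong: measurable_cong_sets)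
    have BL: "B \<in> sets L" using BR L(1) by simp
    have "emeasure L B = emeasure (distr L L (\<lambda>J. \<lambda>e\<in>parcs G. J e + K e)) B" using L(2) by simp
    also have "\<dots> = (\<integral>\<^sup>+J. indicator B J \<partial>distr L L (\<lambda>J. \<lambda>e\<in>parcs G. J e + K e))"
      using BL by simp
    also have "\<dots> = (\<integral>\<^sup>+J. indicator B (\<lambda>e\<in>parcs G. J e + K e) \<partial>L)"
      using BL by (intro nn_integral_distr m) auto
    finally show ?thesis by simp
  qed
  \<comment> \<open>The mass of \<open>{(J, K). J + K \<in> B}\<close> is \<open>M B\<close> or \<open>N B\<close>, depending on the order of integration.\<close>
  have "emeasure M B = (\<integral>\<^sup>+K. \<integral>\<^sup>+J. indicator B (\<lambda>e\<in>parcs G. fst (J, K) e + snd (J, K) e) \<partial>M \<partial>N)"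
  proof -
    have "(\<integral>\<^sup>+K. \<integral>\<^sup>+J. indicator B (\<lambda>e\<in>parcs G. fst (J, K) e + snd (J, K) e) \<partial>M \<partial>N) = (\<integral>\<^sup>+K. emeasure M B \<partial>N)"
      using inner[OF _ sM iM] by (intro nn_integral_cong) (simp add: sp)
    then show ?thesis by (simp add: N.emeasure_space_1)
  qed
  also have "\<dots> = (\<integral>\<^sup>+J. \<integral>\<^sup>+K. indicator B (\<lambda>e\<in>parcs G. fst (J, K) e + snd (J, K) e) \<partial>N \<partial>M)"
    by (rule P.Fubini') (simp add: case_prod_beta)
  also have "\<dots> = emeasure N B"
  proof -
    have "(\<integral>\<^sup>+J. \<integral>\<^sup>+K. indicator B (\<lambda>e\<in>parcs G. fst (J, K) e + snd (J, K) e) \<partial>N \<partial>M) = (\<integral>\<^sup>+J. emeasure N B \<partial>M)"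
      using inner[OF _ sN iN] by (intro nn_integral_cong) (simp add: sp add.commute)
    then show ?thesis by (simp add: M.emeasure_space_1)
  qed
  finally show "emeasure M B = emeasure N B" .
qed

section \<open>Homomorphisms of tori with integer matrices\<close>

text \<open>The group homomorphism with integer matrix \<open>C\<close>, whose rows are indexed by
  \<open>D\<close> and columns by \<open>I\<close>.\<close>

definition torus_map :: "'e set \<Rightarrow> 'i set \<Rightarrow> ('e \<Rightarrow> 'i \<Rightarrow> int) \<Rightarrow> ('i \<Rightarrow> circle) \<Rightarrow> 'e \<Rightarrow> circle"
  where "torus_map D I C t = (\<lambda>e\<in>D. \<Sum>i\<in>I. cpow (C e i) (t i))"

lemma torus_map_add:
  "(\<lambda>e\<in>D. torus_map D I C t e + torus_map D I C s e) = torus_map D I C (\<lambda>i\<in>I. t i + s i)"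
  by (auto simp: torus_map_def cpow_add_right sum.distrib)

lemma measurable_torus_map [measurable]:
  "torus_map D I C \<in> (\<Pi>\<^sub>M i\<in>I. unif_circle) \<rightarrow>\<^sub>M (\<Pi>\<^sub>M e\<in>D. borel)"
proof -
  have "sets (\<Pi>\<^sub>M i\<in>I. unif_circle) = sets (\<Pi>\<^sub>M i\<in>I. borel)" by (intro sets_PiM_cong) auto
  moreover have "torus_map D I C \<in> (\<Pi>\<^sub>M i\<in>I. borel) \<rightarrow>\<^sub>M (\<Pi>\<^sub>M e\<in>D. borel)"
    unfolding torus_map_def[abs_def] by measurable
  ultimately show ?thesis by (simp cong: measurable_cong_sets)
qed

lemma measurable_torus_plus:
  "(\<lambda>t. \<lambda>i\<in>I. t i + s i) \<in> (\<Pi>\<^sub>M i\<in>I. unif_circle) \<rightarrow>\<^sub>M (\<Pi>\<^sub>M i\<in>I. unif_circle)"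
proof (rule measurable_restrict)
  fix i assume "i \<in> I"
  then have "(\<lambda>t. t i) \<in> (\<Pi>\<^sub>M i\<in>I. unif_circle) \<rightarrow>\<^sub>M unif_circle"
    by (rule measurable_component_singleton)
  then show "(\<lambda>t. t i + s i) \<in> (\<Pi>\<^sub>M i\<in>I. unif_circle) \<rightarrow>\<^sub>M unif_circle"
    by (simp add: borel_measurable_circle_plus cong: measurable_cong_sets)
qed

text \<open>Boxes determine the product measure, and a translation acts on a box coordinate by
  coordinate.\<close>

lemma distr_torus_plus:
  assumes "finite I"
  shows "distr (\<Pi>\<^sub>M i\<in>I. unif_circle) (\<Pi>\<^sub>M i\<in>I. unif_circle) (\<lambda>t. \<lambda>i\<in>I. t i + s i) = (\<Pi>\<^sub>M i\<in>I. unif_circle)"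
proof -
  interpret prob_space unif_circle by (rule prob_space_unif_circle)
  interpret product_sigma_finite "\<lambda>_. unif_circle" by unfold_locales
  note [measurable] = measurable_torus_plus
  show ?thesis
  proof (rule PiM_eqI)
    fix A :: "'a \<Rightarrow> circle set" assume A: "\<And>i. i \<in> I \<Longrightarrow> A i \<in> sets unif_circle"
    have "emeasure (distr (\<Pi>\<^sub>M i\<in>I. unif_circle) (\<Pi>\<^sub>M i\<in>I. unif_circle) (\<lambda>t. \<lambda>i\<in>I. t i + s i)) (Pi\<^sub>E I A) =
        emeasure (\<Pi>\<^sub>M i\<in>I. unif_circle) (\<Pi>\<^sub>E i\<in>I. {z. z + s i \<in> A i})"
      using A assms
      by (subst emeasure_distr) (auto simp: space_PiM PiE_iff intro!: sets_PiM_I_finite arg_cong[where f = "emeasure _"])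
    also have "\<dots> = (\<Prod>i\<in>I. emeasure unif_circle {z. z + s i \<in> A i})"
    proof (rule emeasure_PiM[OF assms])
      fix i assume "i \<in> I"
      then have [measurable]: "A i \<in> sets borel" using A by simp
      show "{z. z + s i \<in> A i} \<in> sets unif_circle" by simp
    qed
    also have "\<dots> = (\<Prod>i\<in>I. emeasure unif_circle (A i))"
    proof (rule prod.cong[OF refl])
      fix i assume "i \<in> I"
      then have [measurable]: "A i \<in> sets borel" using A by simp
      have "emeasure unif_circle (A i) = emeasure (distr unif_circle borel (\<lambda>z. z + s i)) (A i)"
        by (simp add: distr_unif_circle_plus)
      also have "\<dots> = emeasure unif_circle {z. z + s i \<in> A i}"
        by (subst emeasure_distr) (auto simp: vimage_def)
      finally show "emeasure unif_circle {z. z + s i \<in> A i} = emeasure unif_circle (A i)" by simp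
    qed
    finally show "emeasure (distr (\<Pi>\<^sub>M i\<in>I. unif_circle) (\<Pi>\<^sub>M i\<in>I. unif_circle) (\<lambda>t. \<lambda>i\<in>I. t i + s i)) (Pi\<^sub>E I A) =
        (\<Prod>i\<in>I. emeasure unif_circle (A i))" .
  qed (auto simp: assms)
qed

text \<open>The target is cut down to the image, because \<open>is_haar_prob\<close> wants the
  subgroup itself as the underlying space.\<close>

definition torus_haar :: "'e set \<Rightarrow> 'i set \<Rightarrow> ('e \<Rightarrow> 'i \<Rightarrow> int) \<Rightarrow> ('e \<Rightarrow> circle) measure"
  where "torus_haar D I C = distr (\<Pi>\<^sub>M i\<in>I. unif_circle)
    (restrict_space (\<Pi>\<^sub>M e\<in>D. borel) (torus_map D I C ` (I \<rightarrow>\<^sub>E UNIV))) (torus_map D I C)"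

lemma measurable_torus_map_restrict:
  "torus_map D I C \<in> (\<Pi>\<^sub>M i\<in>I. unif_circle) \<rightarrow>\<^sub>M
    restrict_space (\<Pi>\<^sub>M e\<in>D. borel) (torus_map D I C ` (I \<rightarrow>\<^sub>E UNIV))"
  by (intro measurable_restrict_space2 measurable_torus_map) (auto simp: space_PiM)

text \<open>Translation by \<open>torus_map D I C s\<close> downstairs is translation by
  \<open>s\<close> upstairs, which preserves the product measure. Uniqueness then identifies
  \<open>haar_prob\<close>.\<close>

lemma haar_prob_torus:
  assumes "finite I" and A: "A = torus_map (parcs G) I C ` (I \<rightarrow>\<^sub>E UNIV)"
  shows "is_haar_prob G A (torus_haar (parcs G) I C)"
    and "haar_prob G A = torus_haar (parcs G) I C"
proof -
  let ?P = "\<Pi>\<^sub>M i\<in>I. unif_circle" and ?D = "parcs G"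
  let ?R = "restrict_space (\<Pi>\<^sub>M e\<in>?D. borel) (torus_map ?D I C ` (I \<rightarrow>\<^sub>E UNIV))"
  interpret U: prob_space unif_circle by (rule prob_space_unif_circle)
  interpret product_prob_space "\<lambda>_. unif_circle" by unfold_locales
  have closed: "(\<lambda>e\<in>?D. J e + K e) \<in> A" if "J \<in> A" "K \<in> A" for J K
    using that unfolding A by (auto simp: torus_map_add)
  have AD: "A \<subseteq> ?D \<rightarrow>\<^sub>E UNIV" by (auto simp: A torus_map_def)
  show "is_haar_prob G A (torus_haar ?D I C)"
    unfolding is_haar_prob_def
  proof (intro conjI ballI)
    show "prob_space (torus_haar ?D I C)"
      unfolding torus_haar_def by (intro prob_space_distr measurable_torus_map_restrict prob_space_PiM U.prob_space_axioms)
    show "space (torus_haar ?D I C) = A" "sets (torus_haar ?D I C) = sets (restrict_space (\<Pi>\<^sub>M e\<in>?D. borel) A)"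
      using AD by (auto simp: torus_haar_def A space_restrict_space space_PiM)
    fix K assume K: "K \<in> A"
    then obtain s where s: "s \<in> I \<rightarrow>\<^sub>E UNIV" "K = torus_map ?D I C s" using A by auto
    have m: "(\<lambda>J. \<lambda>e\<in>?D. J e + K e) \<in> ?R \<rightarrow>\<^sub>M ?R"
    proof (rule measurable_restrict_space2)
      show "(\<lambda>J. \<lambda>e\<in>?D. J e + K e) \<in> space ?R \<rightarrow> torus_map ?D I C ` (I \<rightarrow>\<^sub>E UNIV)"
        using closed K by (auto simp: space_restrict_space A)
      show "(\<lambda>J. \<lambda>e\<in>?D. J e + K e) \<in> ?R \<rightarrow>\<^sub>M (\<Pi>\<^sub>M e\<in>?D. borel)"
      proof (intro measurable_restrict_space1 measurable_restrict)
        fix e assume "e \<in> ?D"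
        then have [measurable]: "(\<lambda>J. J e) \<in> (\<Pi>\<^sub>M e\<in>?D. borel) \<rightarrow>\<^sub>M borel"
          by (rule measurable_component_singleton)
        show "(\<lambda>J. J e + K e) \<in> (\<Pi>\<^sub>M e\<in>?D. borel) \<rightarrow>\<^sub>M borel" by measurable
      qed
    qed
    have "distr (torus_haar ?D I C) (torus_haar ?D I C) (\<lambda>J. \<lambda>e\<in>?D. J e + K e) =
        distr (distr ?P ?R (torus_map ?D I C)) ?R (\<lambda>J. \<lambda>e\<in>?D. J e + K e)"
      by (intro distr_cong) (auto simp: torus_haar_def)
    also have "\<dots> = distr ?P ?R ((\<lambda>J. \<lambda>e\<in>?D. J e + K e) \<circ> torus_map ?D I C)"
      by (intro distr_distr m measurable_torus_map_restrict)
    also have "(\<lambda>J. \<lambda>e\<in>?D. J e + K e) \<circ> torus_map ?D I C = torus_map ?D I C \<circ> (\<lambda>t. \<lambda>i\<in>I. t i + s i)"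
      by (auto simp: fun_eq_iff s torus_map_add[symmetric])
    also have "distr ?P ?R \<dots> = distr (distr ?P ?P (\<lambda>t. \<lambda>i\<in>I. t i + s i)) ?R (torus_map ?D I C)"
      by (intro distr_distr[symmetric] measurable_torus_plus measurable_torus_map_restrict)
    also have "\<dots> = torus_haar ?D I C"
      by (simp add: distr_torus_plus assms torus_haar_def)
    finally show "distr (torus_haar ?D I C) (torus_haar ?D I C) (\<lambda>J. \<lambda>e\<in>?D. J e + K e) = torus_haar ?D I C" .
  qed
  then show "haar_prob G A = torus_haar ?D I C"
    unfolding haar_prob_def
    by (intro the_equality is_haar_prob_unique[of A G, OF closed])
qed

text \<open>Pulled back to the torus, the character with exponents \<open>n\<close> has as exponents
  the pairings of \<open>n\<close> with the columns of \<open>C\<close>. The integral then factors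
  over the coordinates, and a single nonzero exponent kills it.\<close>

lemma integral_torus_haar_character:
  assumes "finite I" "finite E" "E \<subseteq> D"
  shows "(\<integral>J. (\<Prod>e\<in>E. complex_of_circle (J e) powi n e) \<partial>torus_haar D I C) =
    (if \<forall>i\<in>I. (\<Sum>e\<in>E. n e * C e i) = 0 then 1 else 0)"
proof -
  let ?P = "\<Pi>\<^sub>M i\<in>I. unif_circle"
  let ?R = "restrict_space (\<Pi>\<^sub>M e\<in>D. borel) (torus_map D I C ` (I \<rightarrow>\<^sub>E UNIV))"
  interpret U: prob_space unif_circle by (rule prob_space_unif_circle)
  interpret product_sigma_finite "\<lambda>_. unif_circle" by unfold_locales
  have m: "(\<lambda>J. \<Prod>e\<in>E. complex_of_circle (J e) powi n e) \<in> borel_measurable ?R"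
  proof (intro measurable_restrict_space1 borel_measurable_prod)
    fix e assume "e \<in> E"
    then have [measurable]: "(\<lambda>J. J e) \<in> (\<Pi>\<^sub>M e\<in>D. borel) \<rightarrow>\<^sub>M borel"
      using assms by (intro measurable_component_singleton) auto
    show "(\<lambda>J. complex_of_circle (J e) powi n e) \<in> borel_measurable (\<Pi>\<^sub>M e\<in>D. borel)" by measurable
  qed
  have eq: "(\<Prod>e\<in>E. complex_of_circle (torus_map D I C t e) powi n e) =
      (\<Prod>i\<in>I. complex_of_circle (t i) powi (\<Sum>e\<in>E. n e * C e i))" for t
  proof -
    have "(\<Prod>e\<in>E. complex_of_circle (torus_map D I C t e) powi n e) =
        complex_of_circle (\<Sum>e\<in>E. cpow (n e) (\<Sum>i\<in>I. cpow (C e i) (t i)))"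
      using assms unfolding torus_map_def complex_of_circle_sum[of _ E]
      by (intro prod.cong) (auto simp: complex_of_circle_cpow)
    also have "\<dots> = complex_of_circle (\<Sum>i\<in>I. \<Sum>e\<in>E. cpow (n e) (cpow (C e i) (t i)))"
      unfolding cpow_sum_right by (subst sum.swap) simp
    also have "\<dots> = (\<Prod>i\<in>I. complex_of_circle (cpow (\<Sum>e\<in>E. n e * C e i) (t i)))"
      unfolding cpow_sum_left complex_of_circle_sum
      by (simp add: complex_of_circle_cpow mult.commute flip: power_int_mult)
    finally show ?thesis by (simp add: complex_of_circle_cpow)
  qed
  have "(\<integral>J. (\<Prod>e\<in>E. complex_of_circle (J e) powi n e) \<partial>torus_haar D I C) =
      (\<integral>t. (\<Prod>i\<in>I. complex_of_circle (t i) powi (\<Sum>e\<in>E. n e * C e i)) \<partial>?P)"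
    unfolding torus_haar_def by (subst integral_distr[OF measurable_torus_map_restrict m]) (simp add: eq)
  also have "\<dots> = (\<Prod>i\<in>I. \<integral>z. complex_of_circle z powi (\<Sum>e\<in>E. n e * C e i) \<partial>unif_circle)"
    by (rule product_integral_prod) (auto simp: assms integrable_unif_circle_powi)
  also have "\<dots> = (if \<forall>i\<in>I. (\<Sum>e\<in>E. n e * C e i) = 0 then 1 else 0)"
    using assms by (auto simp: integral_unif_circle_powi prod_zero_iff)
  finally show ?thesis .
qed

subsection \<open>Integer forms and circle-valued forms\<close>

locale oriented_graph =
  fixes G :: "'v pair_pre_digraph" and E :: "('v \<times> 'v) set"
  assumes graph: "pair_graph G" and orientation: "orientation G E"
begin

lemma finite_arcs: "finite (parcs G)" and finite_verts: "finite (pverts G)"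
proof -
  interpret pair_graph G by (rule graph)
  show "finite (parcs G)" "finite (pverts G)" by (rule pair_finite_arcs pair_finite_verts)+
qed

lemma arc_sym: "(x, y) \<in> parcs G \<Longrightarrow> (y, x) \<in> parcs G"
proof -
  interpret pair_graph G by (rule graph)
  show "(x, y) \<in> parcs G \<Longrightarrow> (y, x) \<in> parcs G" by (rule arcs_symmetric)
qed

lemma arc_verts: "(x, y) \<in> parcs G \<Longrightarrow> x \<in> pverts G" "(x, y) \<in> parcs G \<Longrightarrow> y \<in> pverts G"
proof -
  interpret pair_graph G by (rule graph)
  show "(x, y) \<in> parcs G \<Longrightarrow> x \<in> pverts G" "(x, y) \<in> parcs G \<Longrightarrow> y \<in> pverts G"
    by (rule in_arcsD1 in_arcsD2, assumption)+
qed

lemma E_subset: "E \<subseteq> parcs G" and E_iff: "(x, y) \<in> parcs G \<Longrightarrow> (x, y) \<in> E \<longleftrightarrow> (y, x) \<notin> E"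
  using orientation by (auto simp: orientation_def)

lemma swap_notin_E: "e \<in> E \<Longrightarrow> prod.swap e \<notin> E"
  using E_subset E_iff by (cases e) auto

lemma finite_E: "finite E"
  using E_subset finite_arcs finite_subset by blast

lemma E_verts: "e \<in> E \<Longrightarrow> fst e \<in> pverts G" "e \<in> E \<Longrightarrow> snd e \<in> pverts G"
  using E_subset arc_verts by (metis prod.collapse subsetD)+

lemma one_formsD: "\<omega> \<in> one_forms G \<Longrightarrow> (x, y) \<in> parcs G \<Longrightarrow> \<omega> (y, x) = - \<omega> (x, y)"
  by (fastforce simp: one_forms_def)

lemma one_formsI:
  assumes "\<omega> \<in> extensional (parcs G)"
    "\<And>x y. (x, y) \<in> parcs G \<Longrightarrow> (y, x) \<in> parcs G \<Longrightarrow> \<omega> (x, y) = - \<omega> (y, x)"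
  shows "\<omega> \<in> one_forms G"
  using assms(1) assms(2)[OF _ arc_sym] by (auto simp: one_forms_def PiE_def)

lemma one_forms_eqI:
  assumes "\<omega> \<in> one_forms G" "\<eta> \<in> one_forms G" "\<And>e. e \<in> E \<Longrightarrow> \<omega> e = \<eta> e"
  shows "\<omega> = \<eta>"
proof (rule PiE_ext)
  show "\<omega> \<in> parcs G \<rightarrow>\<^sub>E UNIV" "\<eta> \<in> parcs G \<rightarrow>\<^sub>E UNIV" using assms by (auto simp: one_forms_def)
  fix e assume e: "e \<in> parcs G"
  obtain x y where xy: "e = (x, y)" by (cases e)
  show "\<omega> e = \<eta> e"
  proof (cases "e \<in> E")
    case False
    then have "(y, x) \<in> E" using E_iff[of x y] e xy by auto
    then have "\<omega> (y, x) = \<eta> (y, x)" using assms by auto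
    then show ?thesis using one_formsD[OF assms(1), of y x] one_formsD[OF assms(2), of y x] e xy
        arc_sym by auto
  qed (use assms in auto)
qed

lemma grad_in_one_forms: "grad G f \<in> one_forms G"
  by (rule one_formsI) (auto simp: grad_def)

text \<open>Each neighbour of \<open>v\<close> is reached by an edge that \<open>E\<close> directs
  either into or out of \<open>v\<close>; antisymmetry gives the outgoing ones a minus sign. The
  result is inflow minus outflow, with every edge used in its chosen direction only.\<close>

lemma codiff_eq_sum_oriented:
  assumes "\<omega> \<in> one_forms G" "v \<in> pverts G"
  shows "codiff G \<omega> v =
    (\<Sum>e\<in>E. if snd e = v then \<omega> e else 0) - (\<Sum>e\<in>E. if fst e = v then \<omega> e else 0)"
proof -
  let ?A = "{y. (y, v) \<in> E}" and ?B = "{y. (v, y) \<in> E}"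
  have fin: "finite ?A" "finite ?B"
    using finite_subset[of ?A "fst ` E"] finite_subset[of ?B "snd ` E"] finite_E by force+
  have "{y. (v, y) \<in> parcs G} = ?A \<union> ?B" "?A \<inter> ?B = {}"
    using E_subset E_iff arc_sym by blast+
  then have "codiff G \<omega> v = (\<Sum>y\<in>?A. \<omega> (y, v)) + (\<Sum>y\<in>?B. \<omega> (y, v))"
    using assms(2) fin by (simp add: codiff_def sum.union_disjoint)
  also have "(\<Sum>y\<in>?B. \<omega> (y, v)) = - (\<Sum>y\<in>?B. \<omega> (v, y))"
    unfolding sum_negf[symmetric] using one_formsD[OF assms(1)] E_subset by (intro sum.cong) auto
  also have "(\<Sum>y\<in>?A. \<omega> (y, v)) = (\<Sum>e\<in>{e \<in> E. snd e = v}. \<omega> e)"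
    by (rule sum.reindex_bij_witness[of _ fst "\<lambda>y. (y, v)"]) auto
  also have "(\<Sum>y\<in>?B. \<omega> (v, y)) = (\<Sum>e\<in>{e \<in> E. fst e = v}. \<omega> e)"
    by (rule sum.reindex_bij_witness[of _ snd "\<lambda>y. (v, y)"]) auto
  finally show ?thesis
    by (simp add: sum.inter_filter[OF finite_E])
qed

text \<open>The unit flow along a single arc.\<close>

definition arc_form :: "'v \<times> 'v \<Rightarrow> 'v \<times> 'v \<Rightarrow> int"
  where "arc_form e = (\<lambda>a\<in>parcs G. of_bool (a = e) - of_bool (a = prod.swap e))"

lemma arc_form_in_one_forms: "arc_form e \<in> one_forms G"
proof (rule one_formsI)
  fix x y assume "(x, y) \<in> parcs G" "(y, x) \<in> parcs G"
  then show "arc_form e (x, y) = - arc_form e (y, x)"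
    by (cases e) (simp add: arc_form_def conj_commute)
qed (simp add: arc_form_def)

lemma codiff_arc_form:
  assumes "(u, v) \<in> parcs G" "x \<in> pverts G"
  shows "codiff G (arc_form (u, v)) x = of_bool (x = v) - of_bool (x = u)"
proof -
  have fin: "finite {y. (x, y) \<in> parcs G}"
    using finite_imageI[OF finite_arcs, of snd] by (auto elim!: finite_subset[rotated] intro: rev_image_eqI)
  have "codiff G (arc_form (u, v)) x =
      (\<Sum>y | (x, y) \<in> parcs G. (if y = u then of_bool (x = v) else 0) - (if y = v then of_bool (x = u) else 0))"
    using assms(2) by (auto simp: codiff_def arc_form_def arc_sym intro!: sum.cong)
  also have "\<dots> = of_bool (x = v) - of_bool (x = u)"
    using assms arc_sym by (auto simp: sum_subtractf fin)
  finally show ?thesis .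
qed

lemma codiff_add: "x \<in> pverts G \<Longrightarrow> codiff G (\<lambda>e\<in>parcs G. \<omega> e + \<eta> e) x = codiff G \<omega> x + codiff G \<eta> x"
proof -
  assume x: "x \<in> pverts G"
  have "(\<Sum>y | (x, y) \<in> parcs G. (\<lambda>e\<in>parcs G. \<omega> e + \<eta> e) (y, x)) =
      (\<Sum>y | (x, y) \<in> parcs G. \<omega> (y, x) + \<eta> (y, x))"
    by (rule sum.cong[OF refl]) (use arc_sym[of x] in simp)
  then show ?thesis using x by (simp add: codiff_def sum.distrib)
qed

lemma codiff_diff: "x \<in> pverts G \<Longrightarrow> codiff G (\<lambda>e\<in>parcs G. \<omega> e - \<eta> e) x = codiff G \<omega> x - codiff G \<eta> x"
proof -
  assume x: "x \<in> pverts G"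
  have "(\<Sum>y | (x, y) \<in> parcs G. (\<lambda>e\<in>parcs G. \<omega> e - \<eta> e) (y, x)) =
      (\<Sum>y | (x, y) \<in> parcs G. \<omega> (y, x) - \<eta> (y, x))"
    by (rule sum.cong[OF refl]) (use arc_sym[of x] in simp)
  then show ?thesis using x by (simp add: codiff_def sum_subtractf)
qed

lemma one_forms_add:
  "\<omega> \<in> one_forms G \<Longrightarrow> \<eta> \<in> one_forms G \<Longrightarrow> (\<lambda>e\<in>parcs G. \<omega> e + \<eta> e) \<in> one_forms G"
proof (rule one_formsI)
  fix x y assume "\<omega> \<in> one_forms G" "\<eta> \<in> one_forms G" "(x, y) \<in> parcs G" "(y, x) \<in> parcs G"
  then show "(\<lambda>e\<in>parcs G. \<omega> e + \<eta> e) (x, y) = - (\<lambda>e\<in>parcs G. \<omega> e + \<eta> e) (y, x)"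
    using one_formsD[of \<omega> x y] one_formsD[of \<eta> x y] by simp
qed simp

lemma one_forms_diff:
  "\<omega> \<in> one_forms G \<Longrightarrow> \<eta> \<in> one_forms G \<Longrightarrow> (\<lambda>e\<in>parcs G. \<omega> e - \<eta> e) \<in> one_forms G"
proof (rule one_formsI)
  fix x y assume "\<omega> \<in> one_forms G" "\<eta> \<in> one_forms G" "(x, y) \<in> parcs G" "(y, x) \<in> parcs G"
  then show "(\<lambda>e\<in>parcs G. \<omega> e - \<eta> e) (x, y) = - (\<lambda>e\<in>parcs G. \<omega> e - \<eta> e) (y, x)"
    using one_formsD[of \<omega> x y] one_formsD[of \<eta> x y] by simp
qed simp

section \<open>Path flows and cycle generators\<close>

text \<open>A representative of the connected component of \<open>v\<close>. The predicate under
  \<open>SOME\<close> depends on the component alone, so adjacent vertices get literally the same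
  representative.\<close>

definition base :: "'v \<Rightarrow> 'v"
  where "base v = (SOME w. (w, v) \<in> (parcs G)\<^sup>*)"

lemma base_reaches: "(base v, v) \<in> (parcs G)\<^sup>*"
  unfolding base_def by (rule someI[of _ v]) simp

lemma base_arc: "(u, v) \<in> parcs G \<Longrightarrow> base u = base v"
proof -
  assume uv: "(u, v) \<in> parcs G"
  have "(w, u) \<in> (parcs G)\<^sup>* \<longleftrightarrow> (w, v) \<in> (parcs G)\<^sup>*" for w
    using uv arc_sym[OF uv] by (meson rtrancl.rtrancl_into_rtrancl)
  then show ?thesis by (simp add: base_def)
qed

text \<open>Adding the unit flow of each further arc makes the codifferentials telescope along the
  path.\<close>

lemma path_form_exists:
  assumes "(w, v) \<in> (parcs G)\<^sup>*"
  shows "\<exists>p :: _ \<Rightarrow> int. p \<in> one_forms G \<and>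
    (\<forall>x\<in>pverts G. codiff G p x = of_bool (x = v) - of_bool (x = w))"
  using assms
proof (induction rule: rtrancl_induct)
  case base
  show ?case
  proof (intro exI conjI ballI)
    show "(\<lambda>e\<in>parcs G. 0) \<in> one_forms G" by (rule one_formsI) auto
    fix x assume "x \<in> pverts G"
    then show "codiff G (\<lambda>e\<in>parcs G. 0) x = of_bool (x = w) - of_bool (x = w)"
      by (simp add: codiff_def arc_sym[of x])
  qed
next
  case (step u v)
  then obtain p :: "_ \<Rightarrow> int" where p: "p \<in> one_forms G"
    "\<forall>x\<in>pverts G. codiff G p x = of_bool (x = u) - of_bool (x = w)" by blast
  show ?case
  proof (intro exI conjI ballI)
    show "(\<lambda>e\<in>parcs G. p e + arc_form (u, v) e) \<in> one_forms G"
      by (intro one_forms_add p arc_form_in_one_forms)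
    fix x assume x: "x \<in> pverts G"
    show "codiff G (\<lambda>e\<in>parcs G. p e + arc_form (u, v) e) x = of_bool (x = v) - of_bool (x = w)"
      unfolding codiff_add[OF x] codiff_arc_form[OF step.hyps(2) x] using p x by simp
  qed
qed

text \<open>A unit flow from \<open>base v\<close> to \<open>v\<close>. The choice among such flows
  is immaterial, since only antisymmetry and the codifferential enter later.\<close>

definition path_form :: "'v \<Rightarrow> 'v \<times> 'v \<Rightarrow> int"
  where "path_form v = (SOME p. p \<in> one_forms G \<and>
    (\<forall>x\<in>pverts G. codiff G p x = of_bool (x = v) - of_bool (x = base v)))"

lemma path_form_in_one_forms: "path_form v \<in> one_forms G"
  and codiff_path_form: "x \<in> pverts G \<Longrightarrow> codiff G (path_form v) x = of_bool (x = v) - of_bool (x = base v)"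
  using someI_ex[OF path_form_exists[OF base_reaches[of v]]] by (auto simp: path_form_def)

text \<open>
  The 1-forms \<open>path_form (fst e) + e - path_form (snd e)\<close> are closed. If \<open>J\<close> has zero codifferential,
  then weighting them by \<open>J e\<close> and summing over \<open>E\<close> cancels the path terms vertex by vertex and
  gives back \<open>J\<close>, so they generate \<open>H Diamond\<close> over every coefficient group, without the choice of a
  spanning forest.
\<close>

definition cycle_form :: "'v \<times> 'v \<Rightarrow> 'v \<times> 'v \<Rightarrow> int"
  where "cycle_form e = (\<lambda>a\<in>parcs G. (\<lambda>a\<in>parcs G. path_form (fst e) a + arc_form e a) a - path_form (snd e) a)"

lemma cycle_form_in_one_forms: "cycle_form e \<in> one_forms G"
  unfolding cycle_form_def
  by (intro one_forms_add one_forms_diff arc_form_in_one_forms path_form_in_one_forms)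

lemma cycle_form_eq:
  "a \<in> parcs G \<Longrightarrow> cycle_form e a = path_form (fst e) a + arc_form e a - path_form (snd e) a"
  by (simp add: cycle_form_def)

text \<open>The point masses at the two ends of \<open>e\<close> cancel, and those at the base
  points cancel because \<open>base\<close> agrees at both ends.\<close>

lemma codiff_cycle_form:
  assumes "e \<in> parcs G" "x \<in> pverts G"
  shows "codiff G (cycle_form e) x = 0"
proof -
  obtain u v where e: "e = (u, v)" by (cases e)
  show ?thesis
    using codiff_arc_form[of u v x] base_arc[of u v] assms
    unfolding cycle_form_def e codiff_diff[OF assms(2)] codiff_add[OF assms(2)] codiff_path_form[OF assms(2)]
    by simp
qed

lemma arc_form_oriented:
  assumes "e \<in> E" "a \<in> parcs G"
  shows "arc_form e a = (if a \<in> E then of_bool (e = a) else - of_bool (e = prod.swap a))"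
proof (cases "a \<in> E")
  case True
  then have "a \<noteq> prod.swap e" using swap_notin_E[OF assms(1)] by metis
  then show ?thesis using True by (simp add: arc_form_def assms(2) eq_commute[of a])
next
  case False
  then have "a \<noteq> e" using assms(1) by metis
  moreover have "a = prod.swap e \<longleftrightarrow> e = prod.swap a" by (metis swap_swap)
  ultimately show ?thesis using False by (simp add: arc_form_def assms(2))
qed

lemma sum_arc_form:
  assumes "e \<in> E"
  shows "(\<Sum>a\<in>E. n a * arc_form e a) = n e"
proof -
  have "(\<Sum>a\<in>E. n a * arc_form e a) = (\<Sum>a\<in>E. if e = a then n a else 0)"
    using E_subset by (intro sum.cong) (auto simp: arc_form_oriented assms)
  then show ?thesis using assms finite_E by simp
qed

text \<open>At each arc exactly one summand survives: the edge of \<open>E\<close> lying over it,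
  with a sign if the arc runs against the orientation.\<close>

lemma sum_cpow_arc_form:
  assumes J: "J \<in> one_forms G" and a: "a \<in> parcs G"
  shows "(\<Sum>e\<in>E. cpow (arc_form e a) (J e)) = J a"
proof -
  obtain x y where xy: "a = (x, y)" by (cases a)
  show ?thesis
  proof (cases "a \<in> E")
    case True
    then have "(\<Sum>e\<in>E. cpow (arc_form e a) (J e)) = (\<Sum>e\<in>E. if e = a then J e else 0)"
      by (intro sum.cong refl) (simp add: arc_form_oriented a)
    then show ?thesis using True finite_E by simp
  next
    case False
    then have yx: "(y, x) \<in> E" using E_iff a xy by auto
    have "(\<Sum>e\<in>E. cpow (arc_form e a) (J e)) = (\<Sum>e\<in>E. if e = (y, x) then - J e else 0)"
      using False
      by (intro sum.cong refl) (simp add: arc_form_oriented a[unfolded xy] xy cpow_minus_left[of 1, simplified])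
    also have "\<dots> = J a" using yx finite_E one_formsD[OF J, of x y] a xy by simp
    finally show ?thesis .
  qed
qed

text \<open>Groups the edges by one endpoint. Taken for \<open>fst\<close> and for
  \<open>snd\<close>, it reduces the cancellation of path terms to equality of inflow and outflow at
  each vertex.\<close>

lemma sum_cpow_endpoint:
  assumes "\<And>e. e \<in> E \<Longrightarrow> h e \<in> pverts G"
  shows "(\<Sum>e\<in>E. cpow (p (h e)) (J e)) = (\<Sum>v\<in>pverts G. cpow (p v) (\<Sum>e\<in>E. if h e = v then J e else 0))"
proof -
  have "(\<Sum>v\<in>pverts G. cpow (p v) (\<Sum>e\<in>E. if h e = v then J e else 0)) =
      (\<Sum>v\<in>pverts G. \<Sum>e\<in>E. if h e = v then cpow (p v) (J e) else 0)"
    unfolding cpow_sum_right by (intro sum.cong refl) auto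
  also have "\<dots> = (\<Sum>e\<in>E. \<Sum>v\<in>pverts G. if h e = v then cpow (p v) (J e) else 0)"
    by (rule sum.swap)
  also have "\<dots> = (\<Sum>e\<in>E. cpow (p (h e)) (J e))"
    using assms finite_verts by (intro sum.cong refl) simp
  finally show ?thesis by simp
qed

lemma sum_mult_endpoint:
  fixes f :: "'v \<Rightarrow> int"
  assumes "\<And>e. e \<in> E \<Longrightarrow> h e \<in> pverts G"
  shows "(\<Sum>e\<in>E. f (h e) * n e) = (\<Sum>v\<in>pverts G. f v * (\<Sum>e\<in>E. if h e = v then n e else 0))"
proof -
  have "(\<Sum>v\<in>pverts G. f v * (\<Sum>e\<in>E. if h e = v then n e else 0)) =
      (\<Sum>v\<in>pverts G. \<Sum>e\<in>E. if h e = v then f v * n e else 0)"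
    unfolding sum_distrib_left by (intro sum.cong refl) auto
  also have "\<dots> = (\<Sum>e\<in>E. \<Sum>v\<in>pverts G. if h e = v then f v * n e else 0)"
    by (rule sum.swap)
  also have "\<dots> = (\<Sum>e\<in>E. f (h e) * n e)"
    using assms finite_verts by (intro sum.cong refl) simp
  finally show ?thesis by simp
qed

text \<open>Summation by parts: \<open>grad\<close> and \<open>codiff\<close> are adjoint. Gradients
  are therefore orthogonal to every cycle form.\<close>

lemma sum_grad_mult:
  fixes f :: "'v \<Rightarrow> int"
  assumes "c \<in> one_forms G"
  shows "(\<Sum>e\<in>E. grad G f e * c e) = (\<Sum>v\<in>pverts G. f v * codiff G c v)"
proof -
  have "(\<Sum>e\<in>E. grad G f e * c e) = (\<Sum>e\<in>E. f (snd e) * c e) - (\<Sum>e\<in>E. f (fst e) * c e)"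
    using E_subset by (auto simp: sum_subtractf[symmetric] grad_def algebra_simps intro!: sum.cong split: prod.splits)
  also have "\<dots> = (\<Sum>v\<in>pverts G. f v * codiff G c v)"
  proof -
    have "(\<Sum>e\<in>E. f (snd e) * c e) = (\<Sum>v\<in>pverts G. f v * (\<Sum>e\<in>E. if snd e = v then c e else 0))"
      "(\<Sum>e\<in>E. f (fst e) * c e) = (\<Sum>v\<in>pverts G. f v * (\<Sum>e\<in>E. if fst e = v then c e else 0))"
      by (rule sum_mult_endpoint, erule E_verts)+
    then show ?thesis
      by (simp add: codiff_eq_sum_oriented assms right_diff_distrib sum_subtractf cong: sum.cong)
  qed
  finally show ?thesis .
qed

lemma H_Diamond_iff: "n \<in> H Diamond G \<longleftrightarrow> n \<in> one_forms G \<and> (\<forall>x\<in>pverts G. codiff G n x = 0)"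
  by (auto simp: codiff_def fun_eq_iff restrict_def)

definition incidence :: "'v \<times> 'v \<Rightarrow> 'v \<Rightarrow> int"
  where "incidence e v = of_bool (v = snd e) - of_bool (v = fst e)"

lemma torus_map_incidence: "torus_map (parcs G) (pverts G) incidence f = grad G f"
proof
  fix e
  show "torus_map (parcs G) (pverts G) incidence f e = grad G f e"
  proof (cases "e \<in> parcs G")
    case True
    obtain x y where e: "e = (x, y)" by (cases e)
    have "(\<Sum>v\<in>pverts G. cpow (incidence e v) (f v)) =
        (\<Sum>v\<in>pverts G. (if v = y then f v else 0) - (if v = x then f v else 0))"
      unfolding incidence_def e by (intro sum.cong refl) (auto simp: cpow_diff_left)
    also have "\<dots> = f y - f x"
      using finite_verts arc_verts[of x y] True e by (simp add: sum_subtractf)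
    finally show ?thesis using True by (simp add: torus_map_def grad_def e)
  qed (auto simp: torus_map_def grad_def)
qed

lemma H_Star_eq_torus: "H Star G = torus_map (parcs G) (pverts G) incidence ` (pverts G \<rightarrow>\<^sub>E UNIV)"
  by (simp add: torus_map_incidence[abs_def] zero_forms_def)

text \<open>\<open>codiff\<close> is the transpose of the incidence matrix on \<open>E\<close>. The
  right-hand side is the orthogonality condition that decides the character integrals over
  \<open>H Star G\<close>.\<close>

lemma H_Diamond_iff_incidence:
  assumes n: "n \<in> one_forms G"
  shows "n \<in> H Diamond G \<longleftrightarrow> (\<forall>v\<in>pverts G. (\<Sum>e\<in>E. n e * incidence e v) = 0)"
proof -
  have "codiff G n v = (\<Sum>e\<in>E. n e * incidence e v)" if "v \<in> pverts G" for v
    unfolding codiff_eq_sum_oriented[OF n that] sum_subtractf[symmetric]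
    by (intro sum.cong) (auto simp: incidence_def)
  then show ?thesis using n unfolding H_Diamond_iff by simp
qed

lemma H_Diamond_eq_torus:
  "H Diamond G = torus_map (parcs G) E (\<lambda>a e. cycle_form e a) ` (E \<rightarrow>\<^sub>E UNIV)"
proof
  show "torus_map (parcs G) E (\<lambda>a e. cycle_form e a) ` (E \<rightarrow>\<^sub>E UNIV) \<subseteq> H Diamond G"
  proof (rule image_subsetI)
    fix t
    let ?J = "torus_map (parcs G) E (\<lambda>a e. cycle_form e a) t"
    have "?J \<in> one_forms G"
    proof (rule one_formsI)
      fix x y assume "(x, y) \<in> parcs G" "(y, x) \<in> parcs G"
      then show "?J (x, y) = - ?J (y, x)"
        using one_formsD[OF cycle_form_in_one_forms, of x y]
        by (simp add: torus_map_def sum_negf cpow_minus_left)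
    qed (simp add: torus_map_def)
    moreover have "codiff G ?J x = 0" if x: "x \<in> pverts G" for x
    proof -
      have "codiff G ?J x = (\<Sum>y | (x, y) \<in> parcs G. \<Sum>e\<in>E. cpow (cycle_form e (y, x)) (t e))"
        using x by (auto simp: codiff_def torus_map_def arc_sym)
      \<comment> \<open>\<open>cpow\<close> is additive in its integer argument, so the
        codifferential moves onto the integer form and closedness passes from integers to the
        circle.\<close>
      also have "\<dots> = (\<Sum>e\<in>E. cpow (codiff G (cycle_form e) x) (t e))"
        using x by (subst sum.swap) (simp add: codiff_def cpow_sum_left)
      also have "\<dots> = 0" using E_subset x by (intro sum.neutral) (auto simp: codiff_cycle_form)
      finally show ?thesis .
    qed
    ultimately show "?J \<in> H Diamond G" unfolding H_Diamond_iff by blast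
  qed
  show "H Diamond G \<subseteq> torus_map (parcs G) E (\<lambda>a e. cycle_form e a) ` (E \<rightarrow>\<^sub>E UNIV)"
  proof
    fix J :: "'v \<times> 'v \<Rightarrow> circle" assume "J \<in> H Diamond G"
    then have J: "J \<in> one_forms G" "\<And>x. x \<in> pverts G \<Longrightarrow> codiff G J x = 0"
      unfolding H_Diamond_iff by auto
    \<comment> \<open>The parameters are the values of \<open>J\<close> on \<open>E\<close>
      themselves.\<close>
    have "torus_map (parcs G) E (\<lambda>a e. cycle_form e a) (restrict J E) a = J a" for a
    proof (cases "a \<in> parcs G")
      case a: True
      have ends: "(\<Sum>e\<in>E. if snd e = v then J e else 0) = (\<Sum>e\<in>E. if fst e = v then J e else 0)"
        if "v \<in> pverts G" for v
        using codiff_eq_sum_oriented[OF J(1) that] J(2)[OF that] by simp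
      have "torus_map (parcs G) E (\<lambda>a e. cycle_form e a) (restrict J E) a =
          (\<Sum>e\<in>E. cpow (path_form (fst e) a) (J e)) + (\<Sum>e\<in>E. cpow (arc_form e a) (J e))
          - (\<Sum>e\<in>E. cpow (path_form (snd e) a) (J e))"
        using a by (simp add: torus_map_def cycle_form_eq cpow_diff_left cpow_add_left sum.distrib sum_subtractf)
      also have "(\<Sum>e\<in>E. cpow (path_form (fst e) a) (J e)) = (\<Sum>e\<in>E. cpow (path_form (snd e) a) (J e))"
        using sum_cpow_endpoint[of fst "\<lambda>v. path_form v a" J, OF E_verts(1)]
          sum_cpow_endpoint[of snd "\<lambda>v. path_form v a" J, OF E_verts(2)] by (simp add: ends)
      also have "(\<Sum>e\<in>E. cpow (path_form (snd e) a) (J e)) + (\<Sum>e\<in>E. cpow (arc_form e a) (J e))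
          - (\<Sum>e\<in>E. cpow (path_form (snd e) a) (J e)) = J a"
        using sum_cpow_arc_form[OF J(1) a] by simp
      finally show ?thesis .
    next
      case False
      then have "J a = undefined"
        using J(1) by (intro PiE_arb[of J "parcs G" "\<lambda>_. UNIV"]) (auto simp: one_forms_def)
      then show ?thesis using False by (simp add: torus_map_def)
    qed
    then have "J = torus_map (parcs G) E (\<lambda>a e. cycle_form e a) (restrict J E)" by (intro ext) (rule sym)
    then show "J \<in> torus_map (parcs G) E (\<lambda>a e. cycle_form e a) ` (E \<rightarrow>\<^sub>E UNIV)"
      using image_eqI[of J "torus_map (parcs G) E (\<lambda>a e. cycle_form e a)" "restrict J E" "E \<rightarrow>\<^sub>E UNIV"]
      by (metis UNIV_I restrict_PiE_iff)
  qed
qed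

text \<open>A discrete Poincare lemma: an integer form whose pairing with every generating cycle
  vanishes has an integer potential.\<close>

lemma H_Star_iff_cycle_form:
  assumes n: "n \<in> one_forms G"
  shows "n \<in> H Star G \<longleftrightarrow> (\<forall>e\<in>E. (\<Sum>a\<in>E. n a * cycle_form e a) = 0)"
proof
  assume "n \<in> H Star G"
  then obtain f where f: "n = grad G f" by auto
  then show "\<forall>e\<in>E. (\<Sum>a\<in>E. n a * cycle_form e a) = 0"
    using E_subset by (auto simp: sum_grad_mult cycle_form_in_one_forms codiff_cycle_form)
next
  assume 0: "\<forall>e\<in>E. (\<Sum>a\<in>E. n a * cycle_form e a) = 0"
  \<comment> \<open>The potential at \<open>v\<close> is the integral of \<open>n\<close> along the
    chosen flow from \<open>base v\<close> to \<open>v\<close>; orthogonality to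
    \<open>cycle_form e\<close> then says exactly that its increment along \<open>e\<close> is
    \<open>n e\<close>.\<close>
  define f where "f = (\<lambda>v\<in>pverts G. \<Sum>a\<in>E. n a * path_form v a)"
  have "n = grad G f"
  proof (rule one_forms_eqI[OF n grad_in_one_forms])
    fix e assume e: "e \<in> E"
    have "0 = (\<Sum>a\<in>E. n a * cycle_form e a)" using 0 e by simp
    also have "\<dots> = (\<Sum>a\<in>E. n a * path_form (fst e) a + n a * arc_form e a - n a * path_form (snd e) a)"
      using E_subset by (intro sum.cong) (auto simp: cycle_form_eq algebra_simps)
    also have "\<dots> = f (fst e) + n e - f (snd e)"
      using E_verts[OF e] by (simp add: f_def sum.distrib sum_subtractf sum_arc_form e)
    finally show "n e = grad G f e"
      using e E_subset by (cases e) (auto simp: grad_def)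
  qed
  then show "n \<in> H Star G" by (auto simp: zero_forms_def f_def)
qed

section \<open>Fourier duality between the two groups\<close>

lemma is_haar_prob_H: "is_haar_prob G (H k G) (haar_prob G (H k G))"
proof (cases k)
  case Star
  note haar = haar_prob_torus[OF finite_verts H_Star_eq_torus]
  show ?thesis unfolding Star using haar(1) by (simp only: haar(2))
next
  case Diamond
  note haar = haar_prob_torus[OF finite_E H_Diamond_eq_torus]
  show ?thesis unfolding Diamond using haar(1) by (simp only: haar(2))
qed

text \<open>The integer group of one kind is the annihilator of the circle group of the other kind:
  the matrix that parametrises the latter also tests membership in the former.\<close>

lemma integral_haar_character:
  assumes n: "n \<in> one_forms G"
  shows "(\<integral>J. (\<Prod>e\<in>E. complex_of_circle (J e) powi n e) \<partial>haar_prob G (H (opp k) G)) =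
    (if n \<in> H k G then 1 else 0)"
proof (cases k)
  case Star
  show ?thesis unfolding Star opp.simps haar_prob_torus(2)[OF finite_E H_Diamond_eq_torus]
      integral_torus_haar_character[OF finite_E finite_E E_subset] H_Star_iff_cycle_form[OF n] ..
next
  case Diamond
  show ?thesis unfolding Diamond opp.simps haar_prob_torus(2)[OF finite_verts H_Star_eq_torus]
      integral_torus_haar_character[OF finite_verts finite_E E_subset] H_Diamond_iff_incidence[OF n] ..
qed

lemma H_subset_one_forms: "H k G \<subseteq> one_forms G"
  by (cases k) (auto simp: grad_in_one_forms)

lemma restrict_inj_on: "inj_on (\<lambda>n. restrict n E) (one_forms G)"
proof (rule inj_onI)
  fix n m :: "'v \<times> 'v \<Rightarrow> 'g::ab_group_add" assume nm: "n \<in> one_forms G" "m \<in> one_forms G" "restrict n E = restrict m E"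
  show "n = m"
  proof (rule one_forms_eqI[OF nm(1,2)])
    fix e assume "e \<in> E"
    then show "n e = m e" using fun_cong[OF nm(3), of e] by simp
  qed
qed

text \<open>Multiplying out a product over \<open>E\<close> produces arbitrary exponent functions on
  \<open>E\<close>; together with \<open>restrict_inj_on\<close> this matches them with integer
  1-forms.\<close>

lemma one_form_extension:
  assumes "m \<in> E \<rightarrow>\<^sub>E UNIV"
  shows "\<exists>n\<in>one_forms G. restrict n E = (m :: _ \<Rightarrow> 'g::ab_group_add)"
proof
  let ?n = "\<lambda>e\<in>parcs G. if e \<in> E then m e else - m (prod.swap e)"
  show "?n \<in> one_forms G"
  proof (rule one_formsI)
    fix x y assume "(x, y) \<in> parcs G" "(y, x) \<in> parcs G"
    then show "?n (x, y) = - ?n (y, x)" using E_iff[of x y] by simp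
  qed simp
  show "restrict ?n E = m"
  proof
    fix e show "restrict ?n E e = m e"
      using assms E_subset by (cases "e \<in> E") (auto simp: PiE_arb[OF assms])
  qed
qed

lemma prob_space_haar: "prob_space (haar_prob G (H k G))"
  and sets_haar: "sets (haar_prob G (H k G)) = sets (restrict_space (\<Pi>\<^sub>M e\<in>parcs G. borel) (H k G))"
  using is_haar_prob_H[of k] by (auto simp: is_haar_prob_def)

lemma measurable_haar_component [measurable]:
  assumes "e \<in> parcs G"
  shows "(\<lambda>J. J e) \<in> borel_measurable (haar_prob G (H k G))"
proof -
  have "(\<lambda>J. J e) \<in> borel_measurable (restrict_space (\<Pi>\<^sub>M e\<in>parcs G. borel) (H k G))"
    using assms by (intro measurable_restrict_space1 measurable_component_singleton)
  then show ?thesis by (simp add: sets_haar cong: measurable_cong_sets)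
qed

text \<open>A Poisson summation formula: the product of Fourier series is multiplied out, sum and
  integral are exchanged, and orthogonality of characters leaves only the exponents in
  \<open>H k G\<close>.\<close>

lemma
  fixes a :: "'v \<times> 'v \<Rightarrow> int \<Rightarrow> complex"
  assumes a: "\<And>e. e \<in> E \<Longrightarrow> integrable (count_space UNIV) (a e)"
  shows integrable_dual: "integrable (count_space (H k G)) (\<lambda>n. \<Prod>e\<in>E. a e (n e))"
    and integral_dual:
    "(\<integral>J. (\<Prod>e\<in>E. \<integral>m. a e m * complex_of_circle (J e) powi m \<partial>count_space UNIV) \<partial>haar_prob G (H (opp k) G)) =
     (\<integral>n. (\<Prod>e\<in>E. a e (n e)) \<partial>count_space (H k G))"
proof -
  let ?M = "haar_prob G (H (opp k) G) :: ('v \<times> 'v \<Rightarrow> circle) measure" and ?P = "E \<rightarrow>\<^sub>E (UNIV :: int set)"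
  let ?S = "(\<lambda>n. restrict n E) ` H k G"
  define b where "b J n = (\<Prod>e\<in>E. a e (n e) * complex_of_circle (J e) powi n e)" for J n
  interpret M: prob_space ?M by (rule prob_space_haar)
  have countable: "countable ?P" by (intro countable_PiE finite_E) auto
  interpret C: sigma_finite_measure "count_space ?P"
    by (rule sigma_finite_measure_count_space_countable[OF countable])
  interpret pair_sigma_finite ?M "count_space ?P" ..
  have az: "integrable (count_space UNIV) (\<lambda>m. a e m * complex_of_circle z powi m)" if "e \<in> E" for e z
    by (rule Bochner_Integration.integrable_bound[OF a[OF that]]) (auto simp: norm_mult norm_power_int)
  \<comment> \<open>Characters have modulus 1, so the summands are dominated uniformly in
    \<open>J\<close>; this is what justifies Fubini.\<close>
  have norm_b: "norm (b J n) = norm (\<Prod>e\<in>E. a e (n e))" for J n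
    by (simp add: b_def norm_mult norm_power_int flip: prod_norm)
  have prod_b: "(\<Prod>e\<in>E. \<integral>m. a e m * complex_of_circle (J e) powi m \<partial>count_space UNIV) =
      (\<integral>n. b J n \<partial>count_space ?P)" for J
    using infsetsum_prod_PiE[of E "\<lambda>_. UNIV" "\<lambda>e m. a e m * complex_of_circle (J e) powi m"] az finite_E
    by (simp add: infsetsum_def Infinite_Set_Sum.abs_summable_on_def b_def)
  have int_a: "integrable (count_space ?P) (\<lambda>n. \<Prod>e\<in>E. a e (n e))"
    using Infinite_Set_Sum.abs_summable_on_prod_PiE[of E "\<lambda>_. UNIV" a] a finite_E
    by (simp add: Infinite_Set_Sum.abs_summable_on_def)
  have b_meas: "(\<lambda>J. b J n) \<in> borel_measurable ?M" for n
    unfolding b_def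
  proof (rule borel_measurable_prod)
    fix e assume "e \<in> E"
    then have [measurable]: "(\<lambda>J. J e) \<in> borel_measurable ?M" using E_subset by auto
    show "(\<lambda>J. a e (n e) * complex_of_circle (J e) powi n e) \<in> borel_measurable ?M" by measurable
  qed
  have meas: "(\<lambda>(J, n). b J n) \<in> borel_measurable (?M \<Otimes>\<^sub>M count_space ?P)"
    unfolding case_prod_unfold
    by (rule measurable_compose_countable'[where f = "\<lambda>n x. b (fst x) n" and g = snd and I = ?P])
       (use countable measurable_compose[OF measurable_fst b_meas] in auto)
  have int: "integrable (?M \<Otimes>\<^sub>M count_space ?P) (\<lambda>(J, n). b J n)"
  proof (rule Fubini_integrable[OF meas])
    have "integrable (count_space ?P) (b J)" for J
      by (rule Bochner_Integration.integrable_bound[OF int_a]) (auto simp: norm_b)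
    then show "AE J in ?M. integrable (count_space ?P) (\<lambda>n. (\<lambda>(J, n). b J n) (J, n))" by simp
  qed (simp add: norm_b)
  have inj: "inj_on (\<lambda>n. restrict n E) (H k G :: (_ \<Rightarrow> int) set)"
    using restrict_inj_on H_subset_one_forms inj_on_subset by blast
  then have bij: "bij_betw (\<lambda>n. restrict n E) (H k G :: (_ \<Rightarrow> int) set) ?S"
    by (simp add: bij_betw_def)
  have SP: "?S \<subseteq> ?P" by auto
  have char: "(\<integral>J. b J n \<partial>?M) = indicator ?S n *\<^sub>R (\<Prod>e\<in>E. a e (n e))" if n: "n \<in> ?P" for n
  proof -
    obtain n' where n': "n' \<in> one_forms G" "restrict n' E = n" using one_form_extension[OF n] by blast
    have n'_eq: "n' e = n e" if "e \<in> E" for e using fun_cong[OF n'(2), of e] that by simp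
    have "n \<in> ?S \<longleftrightarrow> n' \<in> H k G"
    proof
      assume "n \<in> ?S"
      then obtain m where m: "m \<in> H k G" "n = restrict m E" by (rule imageE)
      then have "m = n'"
        using inj_onD[OF restrict_inj_on, of m n'] n' subsetD[OF H_subset_one_forms m(1)] by simp
      then show "n' \<in> H k G" using m(1) by simp
    next
      assume "n' \<in> H k G"
      then show "n \<in> ?S" using n'(2) by (intro image_eqI[of _ _ n']) simp_all
    qed
    moreover have "(\<integral>J. b J n \<partial>?M) = (\<Prod>e\<in>E. a e (n e)) * (\<integral>J. (\<Prod>e\<in>E. complex_of_circle (J e) powi n' e) \<partial>?M)"
      by (simp add: b_def prod.distrib n'_eq)
    ultimately show ?thesis by (simp add: integral_haar_character[OF n'(1)])
  qed
  have "(\<integral>J. (\<Prod>e\<in>E. \<integral>m. a e m * complex_of_circle (J e) powi m \<partial>count_space UNIV) \<partial>?M) =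
      (\<integral>n. (\<integral>J. b J n \<partial>?M) \<partial>count_space ?P)"
    unfolding prod_b using Fubini_integral[OF int] by simp
  also have "\<dots> = (\<integral>n. indicator ?S n *\<^sub>R (\<Prod>e\<in>E. a e (n e)) \<partial>count_space ?P)"
    by (intro Bochner_Integration.integral_cong) (auto simp: char)
  also have "\<dots> = (\<integral>n. (\<Prod>e\<in>E. a e (n e)) \<partial>count_space ?S)"
    using infsetsum_altdef'[OF SP, of "\<lambda>n. \<Prod>e\<in>E. a e (n e)"]
    by (simp add: infsetsum_def set_lebesgue_integral_def)
  also have "\<dots> = (\<integral>n. (\<Prod>e\<in>E. a e (restrict n E e)) \<partial>count_space (H k G))"
    by (rule integral_bij_count_space[OF bij, symmetric])
  also have "\<dots> = (\<integral>n. (\<Prod>e\<in>E. a e (n e)) \<partial>count_space (H k G))" by simp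
  finally show "(\<integral>J. (\<Prod>e\<in>E. \<integral>m. a e m * complex_of_circle (J e) powi m \<partial>count_space UNIV) \<partial>?M) =
     (\<integral>n. (\<Prod>e\<in>E. a e (n e)) \<partial>count_space (H k G))" .
  have "integrable (count_space ?S) (\<lambda>n. \<Prod>e\<in>E. a e (n e))"
    using Infinite_Set_Sum.abs_summable_on_subset[OF _ SP] int_a
    by (auto simp: Infinite_Set_Sum.abs_summable_on_def)
  then have "integrable (count_space (H k G)) (\<lambda>n. \<Prod>e\<in>E. a e (restrict n E e))"
    by (rule integrable_bij_count_space[OF bij, THEN iffD2])
  then show "integrable (count_space (H k G)) (\<lambda>n. \<Prod>e\<in>E. a e (n e))" by simp
qed

end

subsection \<open>The spin weight\<close>

text \<open>Bridges absolutely convergent sums over all integers and the one-sided series in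
  \<open>spin_weight\<close>: the frequencies \<open>k + 1\<close> and \<open>- (k + 1)\<close> are
  paired, and frequency 0 is split off.\<close>

lemma integral_count_space_int:
  fixes f :: "int \<Rightarrow> complex"
  assumes f: "integrable (count_space UNIV) f"
  shows "(\<lambda>k. f (int (Suc k)) + f (- int (Suc k))) sums ((\<integral>m. f m \<partial>count_space UNIV) - f 0)"
proof -
  let ?p = "\<lambda>k. int (Suc k)" and ?m = "\<lambda>k. - int (Suc k)"
  have U: "(UNIV :: int set) = {0} \<union> (range ?p \<union> range ?m)"
  proof -
    have "m \<in> {0} \<union> (range ?p \<union> range ?m)" for m :: int
      by (cases m rule: int_cases3) (auto simp: image_iff intro: exI[of _ "nat (\<bar>m\<bar> - 1)"])
    then show ?thesis by blast
  qed
  have summable: "Infinite_Set_Sum.abs_summable_on f A" for A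
    using Infinite_Set_Sum.abs_summable_on_subset[of f UNIV A] f by (simp add: Infinite_Set_Sum.abs_summable_on_def)
  have half: "(\<lambda>k. f (g k)) sums infsetsum f (range g)" if g: "inj g" for g :: "nat \<Rightarrow> int"
  proof -
    have "integrable (count_space UNIV) (\<lambda>k. f (g k))"
      using summable[of "range g"] integrable_bij_count_space[OF inj_on_imp_bij_betw[OF g], of f]
      by (simp add: Infinite_Set_Sum.abs_summable_on_def)
    then have "(\<lambda>k. f (g k)) sums (\<integral>k. f (g k) \<partial>count_space UNIV)"
      by (rule sums_integral_count_space_nat)
    then show ?thesis
      using integral_bij_count_space[OF inj_on_imp_bij_betw[OF g], of f] by (simp add: infsetsum_def)
  qed
  have "infsetsum f UNIV = infsetsum f {0} + infsetsum f (range ?p \<union> range ?m)"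
    by (subst U, rule infsetsum_Un_disjoint) (auto intro: summable)
  also have "infsetsum f (range ?p \<union> range ?m) = infsetsum f (range ?p) + infsetsum f (range ?m)"
    by (rule infsetsum_Un_disjoint) (auto intro: summable)
  finally have "infsetsum f (range ?p) + infsetsum f (range ?m) = (\<integral>m. f m \<partial>count_space UNIV) - f 0"
    by (simp add: infsetsum_def lebesgue_integral_count_space_finite)
  then show ?thesis
    using sums_add[OF half[of ?p] half[of ?m]] by (simp add: inj_on_def)
qed

locale height_pot =
  fixes V :: "int \<Rightarrow> ereal"
  assumes height: "height_potential V"
begin

section \<open>Fourier series of the weight and its derivatives\<close>

definition c :: "int \<Rightarrow> real" where "c m = exp_neg (V m)"

lemma c_nonneg: "c m \<ge> 0" by (simp add: c_def exp_neg_def)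

lemma c_minus: "c (- m) = c m"
  using height by (simp add: c_def height_potential_def)

lemma integrable_c2: "integrable (count_space UNIV) (\<lambda>m. (real_of_int m)\<^sup>2 * c m)"
proof -
  have "(\<lambda>m. (real_of_int m)\<^sup>2 * c m) summable_on UNIV"
    using height by (simp add: height_potential_def c_def)
  then have "(\<lambda>m. norm ((real_of_int m)\<^sup>2 * c m)) summable_on UNIV"
    using c_nonneg by (simp add: abs_mult)
  then show ?thesis
    unfolding abs_summable_equivalent Infinite_Set_Sum.abs_summable_on_def .
qed

text \<open>\<open>fc j\<close> are the Fourier coefficients of the \<open>j\<close>-th derivative \<open>w j\<close> of the spin weight.\<close>

definition fc :: "nat \<Rightarrow> int \<Rightarrow> complex"
  where "fc j m = (\<i> * of_int m) ^ j * of_real (c m)"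

lemma norm_fc: "norm (fc j m) = \<bar>real_of_int m\<bar> ^ j * c m"
  using c_nonneg[of m] by (simp add: fc_def norm_mult norm_power)

text \<open>For \<open>m\<close> other than 0 the second moment dominates the lower ones; the extra
  indicator restores the term at 0, which the factor \<open>m^2\<close> suppresses.\<close>

lemma integrable_fc:
  assumes "j \<le> 2"
  shows "integrable (count_space UNIV) (fc j)"
proof (rule Bochner_Integration.integrable_bound)
  have "integrable (count_space UNIV) (\<lambda>m. indicator {0::int} m * c 0)"
    by (intro integrable_mult_left integrable_real_indicator) auto
  then show "integrable (count_space UNIV) (\<lambda>m. (real_of_int m)\<^sup>2 * c m + indicator {0} m * c 0)"
    using integrable_c2 by simp
  have "\<bar>real_of_int m\<bar> ^ j * c m \<le> (real_of_int m)\<^sup>2 * c m + indicator {0} m * c 0" for m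
  proof (cases "m = 0")
    case True
    then show ?thesis using c_nonneg[of 0] by (cases j) auto
  next
    case False
    then have "\<bar>real_of_int m\<bar> ^ j \<le> \<bar>real_of_int m\<bar> ^ 2"
      using assms by (intro power_increasing) auto
    then show ?thesis using False c_nonneg[of m] by (simp add: mult_right_mono)
  qed
  then show "AE m in count_space UNIV. norm (fc j m) \<le> norm ((real_of_int m)\<^sup>2 * c m + indicator {0} m * c 0)"
    using c_nonneg by (simp add: norm_fc)
qed simp

text \<open>Amplitude of frequency \<open>k + 1\<close> in the \<open>j\<close>-th derivative; the
  factor 2 comes from pairing a frequency with its negative.\<close>

definition r :: "nat \<Rightarrow> nat \<Rightarrow> real"
  where "r j k = 2 * real (Suc k) ^ j * c (int (Suc k))"

lemma r_nonneg: "r j k \<ge> 0" using c_nonneg by (simp add: r_def)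

lemma summable_r:
  assumes "j \<le> 2"
  shows "summable (r j)"
proof -
  have "integrable (count_space UNIV) (\<lambda>m. of_real (norm (fc j m)) :: complex)"
    using integrable_fc[OF assms] by (simp add: complex_of_real_integrable_eq)
  from integral_count_space_int[OF this]
  have "summable (\<lambda>k. of_real (norm (fc j (int (Suc k)))) + of_real (norm (fc j (- int (Suc k)))) :: complex)"
    by (rule sums_summable)
  also have "(\<lambda>k. of_real (norm (fc j (int (Suc k)))) + of_real (norm (fc j (- int (Suc k)))) :: complex) =
      (\<lambda>k. of_real (r j k))"
    unfolding norm_fc c_minus by (simp add: r_def fun_eq_iff add.commute)
  finally show ?thesis using summable_of_real_iff by blast
qed

text \<open>Kept as a real trigonometric series, so that \<open>w 0\<close> unfolds to
  \<open>spin_weight V\<close> and termwise differentiation applies.\<close>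

definition w :: "nat \<Rightarrow> real \<Rightarrow> real"
  where "w j \<alpha> = (if j = 0 then c 0 + (\<Sum>k. r 0 k * cos (real (Suc k) * \<alpha>))
    else if j = 1 then (\<Sum>k. - r 1 k * sin (real (Suc k) * \<alpha>))
    else (\<Sum>k. - r 2 k * cos (real (Suc k) * \<alpha>)))"

lemma summable_r_mult:
  assumes "j \<le> 2" "\<And>k. \<bar>t k\<bar> \<le> 1"
  shows "summable (\<lambda>k. r j k * t k)"
proof (rule summable_comparison_test'[OF summable_r[OF assms(1)]])
  fix k show "norm (r j k * t k) \<le> r j k"
    using assms(2)[of k] r_nonneg[of j k] by (simp add: abs_mult mult_left_le)
qed

text \<open>As a function of \<open>m\<close>, the coefficient \<open>fc j m\<close> is even for
  even \<open>j\<close> and odd for odd \<open>j\<close>, so paired frequencies collapse to cosines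
  or sines.\<close>

lemma w_eq_integral:
  assumes "j \<le> 2"
  shows "(\<integral>m. fc j m * cis \<alpha> powi m \<partial>count_space UNIV) = of_real (w j \<alpha>)"
proof -
  have int: "integrable (count_space UNIV) (\<lambda>m. fc j m * cis \<alpha> powi m)"
    by (rule Bochner_Integration.integrable_bound[OF integrable_fc[OF assms]]) (auto simp: norm_mult norm_power_int)
  have cis: "cis \<alpha> powi int (Suc k) = cis (real (Suc k) * \<alpha>)" "cis \<alpha> powi (- int (Suc k)) = cis (- (real (Suc k) * \<alpha>))" for k
    by (simp_all only: cis_power_int) (simp_all add: algebra_simps)
  have eq: "fc j (int (Suc k)) * cis \<alpha> powi int (Suc k) + fc j (- int (Suc k)) * cis \<alpha> powi (- int (Suc k)) =
     of_real (if j = 0 then r 0 k * cos (real (Suc k) * \<alpha>) else if j = 1 then - r 1 k * sin (real (Suc k) * \<alpha>)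
       else - r 2 k * cos (real (Suc k) * \<alpha>))" for k
  proof -
    consider "j = 0" | "j = 1" | "j = 2" using assms by linarith
    then show ?thesis
      unfolding cis fc_def c_minus r_def
      by cases (simp_all add: complex_eq_iff power2_eq_square algebra_simps del: of_nat_Suc)
  qed
  let ?t = "\<lambda>k. if j = 0 then r 0 k * cos (real (Suc k) * \<alpha>) else if j = 1 then - r 1 k * sin (real (Suc k) * \<alpha>)
       else - r 2 k * cos (real (Suc k) * \<alpha>)"
  have "(\<lambda>k. complex_of_real (?t k)) sums ((\<integral>m. fc j m * cis \<alpha> powi m \<partial>count_space UNIV) - fc j 0)"
    using integral_count_space_int[OF int] unfolding eq by simp
  moreover have "?t sums (\<Sum>k. ?t k)"
    using summable_r_mult[of 0 "\<lambda>k. cos (real (Suc k) * \<alpha>)"] summable_r_mult[of 1 "\<lambda>k. - sin (real (Suc k) * \<alpha>)"]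
      summable_r_mult[of 2 "\<lambda>k. - cos (real (Suc k) * \<alpha>)"]
    by (intro summable_sums) (cases "j = 0"; cases "j = 1"; simp del: of_nat_Suc)
  then have "(\<lambda>k. complex_of_real (?t k)) sums of_real (\<Sum>k. ?t k)" by (rule sums_of_real)
  ultimately have "(\<integral>m. fc j m * cis \<alpha> powi m \<partial>count_space UNIV) - fc j 0 = of_real (\<Sum>k. ?t k)"
    by (rule sums_unique2)
  then have "(\<integral>m. fc j m * cis \<alpha> powi m \<partial>count_space UNIV) = fc j 0 + of_real (\<Sum>k. ?t k)"
    by (simp only: diff_eq_eq add.commute)
  also have "\<dots> = of_real (w j \<alpha>)"
  proof -
    consider "j = 0" | "j = 1" | "j = 2" using assms by linarith
    then show ?thesis by cases (simp_all add: w_def fc_def)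
  qed
  finally show ?thesis .
qed

lemma w_0: "w 0 = spin_weight V"
  by (simp add: fun_eq_iff w_def spin_weight_def r_def c_def)

lemma w_0_pos: "w 0 \<alpha> > 0"
  using height by (simp add: w_0 height_potential_def)

lemma uniformly_convergent_r_mult:
  assumes "j \<le> 2" "\<And>k x. \<bar>t k x\<bar> \<le> 1"
  shows "uniformly_convergent_on UNIV (\<lambda>n x. \<Sum>k<n. r j k * t k x)"
proof (rule Weierstrass_m_test')
  show "norm (r j k * t k x) \<le> r j k" for k x
    using assms(2)[of k x] r_nonneg[of j k] by (simp add: abs_mult mult_left_le)
qed (rule summable_r[OF assms(1)])

text \<open>Termwise differentiation: the differentiated series converges uniformly by the
  Weierstrass test with majorant \<open>r 1\<close>, and the original series converges at the point
  0.\<close>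

lemma DERIV_w_0: "(w 0 has_field_derivative w 1 \<alpha>) (at \<alpha>)"
proof -
  have "((\<lambda>x. \<Sum>k. r 0 k * cos (real (Suc k) * x)) has_field_derivative
      (\<Sum>k. r 1 k * - sin (real (Suc k) * \<alpha>))) (at \<alpha>)"
  proof (rule has_field_derivative_series'(2)[of UNIV _ _ 0])
    show "((\<lambda>x. r 0 k * cos (real (Suc k) * x)) has_field_derivative r 1 k * - sin (real (Suc k) * x)) (at x within UNIV)" for k x
      by (auto intro!: derivative_eq_intros simp: r_def simp del: of_nat_Suc)
    show "uniformly_convergent_on UNIV (\<lambda>n x. \<Sum>k<n. r 1 k * - sin (real (Suc k) * x))"
      by (rule uniformly_convergent_r_mult) auto
  qed (auto intro!: summable_r_mult summable_r)
  then have "((\<lambda>x. c 0 + (\<Sum>k. r 0 k * cos (real (Suc k) * x))) has_field_derivative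
      (\<Sum>k. r 1 k * - sin (real (Suc k) * \<alpha>))) (at \<alpha>)"
    by (auto intro!: derivative_eq_intros)
  then show ?thesis by (simp add: w_def[abs_def])
qed

text \<open>The same argument one order higher, with majorant \<open>r 2\<close>; here the full
  second-moment condition on the potential is used.\<close>

lemma DERIV_w_1: "(w 1 has_field_derivative w 2 \<alpha>) (at \<alpha>)"
proof -
  have "((\<lambda>x. \<Sum>k. r 1 k * - sin (real (Suc k) * x)) has_field_derivative
      (\<Sum>k. r 2 k * - cos (real (Suc k) * \<alpha>))) (at \<alpha>)"
  proof (rule has_field_derivative_series'(2)[of UNIV _ _ 0])
    show "((\<lambda>x. r 1 k * - sin (real (Suc k) * x)) has_field_derivative r 2 k * - cos (real (Suc k) * x)) (at x within UNIV)" for k x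
      by (auto intro!: derivative_eq_intros simp: r_def power2_eq_square simp del: of_nat_Suc)
    show "uniformly_convergent_on UNIV (\<lambda>n x. \<Sum>k<n. r 2 k * - cos (real (Suc k) * x))"
      by (rule uniformly_convergent_r_mult) auto
  qed (auto intro!: summable_r_mult summable_r)
  then show ?thesis by (simp add: w_def[abs_def])
qed

lemma deriv_spin_potential: "deriv (spin_potential V) = (\<lambda>\<alpha>. - w 1 \<alpha> / w 0 \<alpha>)"
proof
  fix \<alpha>
  have "((\<lambda>x. - ln (w 0 x)) has_field_derivative - w 1 \<alpha> / w 0 \<alpha>) (at \<alpha>)"
    using w_0_pos by (auto intro!: derivative_eq_intros DERIV_w_0)
  then show "deriv (spin_potential V) \<alpha> = - w 1 \<alpha> / w 0 \<alpha>"
    unfolding spin_potential_def[abs_def] w_0[symmetric] by (rule DERIV_imp_deriv)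
qed

lemma deriv_deriv_spin_potential:
  "deriv (deriv (spin_potential V)) \<alpha> = (w 1 \<alpha> / w 0 \<alpha>)\<^sup>2 - w 2 \<alpha> / w 0 \<alpha>"
proof -
  have "((\<lambda>\<alpha>. - w 1 \<alpha> / w 0 \<alpha>) has_field_derivative (w 1 \<alpha> / w 0 \<alpha>)\<^sup>2 - w 2 \<alpha> / w 0 \<alpha>) (at \<alpha>)"
    using w_0_pos[of \<alpha>]
    by (auto intro!: derivative_eq_intros DERIV_w_0 DERIV_w_1[unfolded One_nat_def] simp: field_simps power2_eq_square)
  then show ?thesis unfolding deriv_spin_potential by (rule DERIV_imp_deriv)
qed

lemma w_bounded:
  assumes "j \<le> 2"
  shows "\<bar>w j \<alpha>\<bar> \<le> (\<integral>m. norm (fc j m) \<partial>count_space UNIV)"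
proof -
  have "\<bar>w j \<alpha>\<bar> = norm (\<integral>m. fc j m * cis \<alpha> powi m \<partial>count_space UNIV)"
    by (simp add: w_eq_integral assms)
  also have "\<dots> \<le> (\<integral>m. norm (fc j m * cis \<alpha> powi m) \<partial>count_space UNIV)" by (rule integral_norm_bound)
  finally show ?thesis by (simp add: norm_mult norm_power_int)
qed

text \<open>Compactness turns pointwise positivity into a uniform bound, which makes the quotients
  by \<open>w 0\<close> bounded.\<close>

lemma w_0_bounded_below: "\<exists>\<delta>>0. \<forall>z. w 0 (angle z) \<ge> \<delta>"
proof -
  have "continuous_on {-pi..pi} (w 0)"
    by (intro continuous_at_imp_continuous_on ballI DERIV_isCont[OF DERIV_w_0])
  then obtain x where x: "\<forall>y\<in>{-pi..pi}. w 0 x \<le> w 0 y"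
    using continuous_attains_inf[of "{-pi..pi}" "w 0"] by auto
  have "angle z \<in> {-pi..pi}" for z
    unfolding angle_def using Arg_bounded[of "complex_of_circle z"] by auto
  then show ?thesis using x w_0_pos by blast
qed

text \<open>\<open>angle\<close> jumps at -1, so measurability is read off from the trigonometric
  terms, which are real and imaginary parts of powers of the circle point.\<close>

lemma borel_measurable_w_angle [measurable]: "(\<lambda>z. w j (angle z)) \<in> borel_measurable borel"
proof -
  have eqs: "cos (real n * angle z) = Re (complex_of_circle z ^ n)" "sin (real n * angle z) = Im (complex_of_circle z ^ n)" for n z
    unfolding complex_of_circle_eq_cis_angle Complex.DeMoivre by simp_all
  show ?thesis unfolding w_def eqs by measurable
qed

text \<open>\<open>exp_neg\<close> turns sums into products away from \<open>-\<infinity>\<close>,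
  so the induction also carries the fact that partial sums avoid this value. The value
  \<open>+\<infinity>\<close> is allowed and contributes a factor 0.\<close>

lemma exp_neg_sum:
  assumes "finite A"
  shows "exp_neg (\<Sum>e\<in>A. V (n e)) = (\<Prod>e\<in>A. c (n e))"
proof -
  have V: "V m \<noteq> - \<infinity>" for m using height by (simp add: height_potential_def)
  have plus: "exp_neg (x + y) = exp_neg x * exp_neg y" if "x \<noteq> - \<infinity>" "y \<noteq> - \<infinity>" for x y
    using that by (cases x; cases y) (auto simp: exp_neg_def mult_exp_exp)
  have "(\<Sum>e\<in>A. V (n e)) \<noteq> - \<infinity> \<and> exp_neg (\<Sum>e\<in>A. V (n e)) = (\<Prod>e\<in>A. c (n e))"
    using assms by induction (auto simp: V plus c_def exp_neg_def[of 0])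
  then show ?thesis ..
qed

end

text \<open>Measurability and nonnegativity suffice: a non-integrable integrand gives 0 on both
  sides, and so does total mass 0, by the convention \<open>x / 0 = 0\<close>.\<close>

lemma integral_prob_density:
  fixes f :: "'a \<Rightarrow> real"
  assumes [measurable]: "f \<in> borel_measurable M" "g \<in> borel_measurable M"
    and g: "\<And>x. x \<in> space M \<Longrightarrow> g x \<ge> 0"
  shows "(\<integral>x. f x \<partial>prob_density M g) = (\<integral>x. g x * f x \<partial>M) / (\<integral>x. g x \<partial>M)"
proof -
  have "(\<integral>x. g x \<partial>M) \<ge> 0" using g by (simp add: integral_nonneg_AE)
  then have "(\<integral>x. f x \<partial>prob_density M g) = (\<integral>x. (g x / (\<integral>x. g x \<partial>M)) *\<^sub>R f x \<partial>M)"
    unfolding prob_density_def using g by (intro integral_density) auto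
  then show ?thesis by simp
qed

subsection \<open>Duality of covariances\<close>

text \<open>Both derivatives are polynomials in the ratios \<open>w j / w 0\<close>: the numerators
  are bounded by absolute Fourier sums, the denominator is bounded away from 0.\<close>

lemma (in height_pot) spin_derivs_bounded:
  "\<exists>K. \<forall>z. \<bar>deriv (spin_potential V) (angle z)\<bar> \<le> K \<and> \<bar>deriv (deriv (spin_potential V)) (angle z)\<bar> \<le> K"
proof -
  obtain \<delta> where \<delta>: "\<delta> > 0" "\<And>z. w 0 (angle z) \<ge> \<delta>" using w_0_bounded_below by blast
  define B where "B j = (\<integral>m. norm (fc j m) \<partial>count_space UNIV) / \<delta>" for j
  have ratio: "\<bar>w j (angle z) / w 0 (angle z)\<bar> \<le> B j" if "j \<le> 2" for j z
    unfolding B_def abs_divide using \<delta>(1) \<delta>(2)[of z] w_bounded[OF that, of "angle z"]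
    by (intro frac_le) auto
  have "\<bar>deriv (spin_potential V) (angle z)\<bar> \<le> B 1" for z
    using ratio[of 1 z] by (simp add: deriv_spin_potential)
  moreover have "\<bar>deriv (deriv (spin_potential V)) (angle z)\<bar> \<le> (B 1)\<^sup>2 + B 2" for z
  proof -
    have "\<bar>(w 1 (angle z) / w 0 (angle z))\<^sup>2\<bar> \<le> (B 1)\<^sup>2"
      using power_mono[OF ratio[of 1 z] abs_ge_zero, of 2] by (simp only: power2_abs abs_power2)
    then show ?thesis
      using ratio[of 2 z] unfolding deriv_deriv_spin_potential by linarith
  qed
  ultimately show ?thesis
    by (intro exI[of _ "max (B 1) ((B 1)\<^sup>2 + B 2)"]) (simp add: le_max_iff_disj)
qed

lemma (in height_pot) borel_measurable_spin_derivs [measurable]: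
  "(\<lambda>z. deriv (spin_potential V) (angle z)) \<in> borel_measurable borel"
  "(\<lambda>z. deriv (deriv (spin_potential V)) (angle z)) \<in> borel_measurable borel"
  unfolding deriv_spin_potential deriv_deriv_spin_potential[unfolded deriv_spin_potential] by measurable

section \<open>The duality for two edges and its bilinear extension\<close>

locale spin_height_duality = oriented_graph G E + height_pot V
  for G :: "'v pair_pre_digraph" and E :: "('v \<times> 'v) set" and V :: "int \<Rightarrow> ereal" +
  fixes k :: kind
begin

abbreviation \<mu> :: "('v \<times> 'v \<Rightarrow> circle) measure" where "\<mu> \<equiv> haar_prob G (H (opp k) G)"

abbreviation U1 :: "circle \<Rightarrow> real" where "U1 z \<equiv> deriv (spin_potential V) (angle z)"

abbreviation U2 :: "circle \<Rightarrow> real" where "U2 z \<equiv> deriv (deriv (spin_potential V)) (angle z)"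

definition weight :: "('v \<times> 'v \<Rightarrow> circle) \<Rightarrow> real"
  where "weight J = (\<Prod>e\<in>E. w 0 (angle (J e)))"

definition height_weight :: "('v \<times> 'v \<Rightarrow> int) \<Rightarrow> real"
  where "height_weight n = (\<Prod>e\<in>E. c (n e))"

text \<open>
  Differentiating the weight once at \<open>e\<close> and once at \<open>e'\<close> puts the derivative of order
  \<open>marks e e' g\<close> on the factor of the edge \<open>g\<close>; the case \<open>e = e'\<close> produces the second derivative.
\<close>

definition marks :: "'v \<times> 'v \<Rightarrow> 'v \<times> 'v \<Rightarrow> 'v \<times> 'v \<Rightarrow> nat"
  where "marks e e' g = of_bool (g = e) + of_bool (g = e')"

lemma marks_le: "marks e e' g \<le> 2"
  by (auto simp: marks_def)

lemma measurable_edge: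
  assumes "e \<in> E" and f: "f \<in> borel_measurable borel"
  shows "(\<lambda>J. f (J e)) \<in> borel_measurable \<mu>"
  using measurable_compose[OF measurable_haar_component f] E_subset assms by blast

lemma integral_prod_w:
  assumes d: "\<And>e. d e \<le> 2"
  shows "complex_of_real (\<integral>J. (\<Prod>e\<in>E. w (d e) (angle (J e))) \<partial>\<mu>) =
    (\<integral>n. (\<Prod>e\<in>E. fc (d e) (n e)) \<partial>count_space (H k G))"
proof -
  have "complex_of_real (\<integral>J. (\<Prod>e\<in>E. w (d e) (angle (J e))) \<partial>\<mu>) =
      (\<integral>J. (\<Prod>e\<in>E. \<integral>m. fc (d e) m * complex_of_circle (J e) powi m \<partial>count_space UNIV) \<partial>\<mu>)"
    by (simp add: complex_of_circle_eq_cis_angle w_eq_integral[OF d] flip: of_real_prod)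
  then show ?thesis by (simp add: integral_dual integrable_fc d)
qed

lemma prod_fc_0: "(\<Prod>e\<in>E. fc 0 (n e)) = of_real (height_weight n)"
  by (simp add: fc_def height_weight_def)

text \<open>The marks add up in the exponent of \<open>\<i> * of_int m\<close>, so the factors of
  the two marks separate even when they sit on the same edge.\<close>

lemma prod_fc_marks:
  assumes "e \<in> E" "e' \<in> E"
  shows "(\<Prod>g\<in>E. fc (marks e e' g) (n g)) = of_real (- (n e * n e' * height_weight n))"
proof -
  have "(\<Prod>g\<in>E. fc (marks e e' g) (n g)) = (\<Prod>g\<in>E. (if g = e then \<i> * of_int (n g) else 1) *
      (if g = e' then \<i> * of_int (n g) else 1) * of_real (c (n g)))"
    by (intro prod.cong refl) (simp add: fc_def marks_def)
  also have "\<dots> = (\<i> * of_int (n e)) * (\<i> * of_int (n e')) * of_real (height_weight n)"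
    using assms finite_E by (simp add: prod.distrib height_weight_def)
  finally show ?thesis by (simp add: algebra_simps)
qed

lemma integrable_marks:
  assumes "e \<in> E" "e' \<in> E"
  shows "integrable (count_space (H k G)) (\<lambda>n. real_of_int (n e) * real_of_int (n e') * height_weight n)"
proof -
  have "integrable (count_space (H k G)) (\<lambda>n. \<Prod>g\<in>E. fc (marks e e' g) (n g))"
    by (intro integrable_dual integrable_fc marks_le)
  then show ?thesis
    unfolding prod_fc_marks[OF assms] complex_of_real_integrable_eq by simp
qed

text \<open>The duality with no marks: the partition functions coincide.\<close>

lemma integral_weight: "(\<integral>J. weight J \<partial>\<mu>) = (\<integral>n. height_weight n \<partial>count_space (H k G))"
proof -
  have "complex_of_real (\<integral>J. weight J \<partial>\<mu>) = of_real (\<integral>n. height_weight n \<partial>count_space (H k G))"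
    unfolding weight_def integral_prod_w[of "\<lambda>_. 0", simplified] prod_fc_0 integral_complex_of_real ..
  then show ?thesis by (simp only: of_real_eq_iff)
qed

lemma prod_w_marks:
  assumes "e \<in> E" "e' \<in> E"
  shows "(\<Prod>g\<in>E. w (marks e e' g) (angle (J g))) =
    weight J * U1 (J e) * U1 (J e') - of_bool (e = e') * (weight J * U2 (J e))"
proof (cases "e = e'")
  case True
  \<comment> \<open>Positivity of \<open>w 0\<close> allows the marked factor to be written as
    \<open>w 0\<close> times a ratio, so that the full weight splits off.\<close>
  have "(\<Prod>g\<in>E. w (marks e e' g) (angle (J g))) =
      (\<Prod>g\<in>E. w 0 (angle (J g)) * (if g = e then w 2 (angle (J g)) / w 0 (angle (J g)) else 1))"
    using True w_0_pos by (intro prod.cong refl) (simp add: marks_def less_imp_neq[symmetric] numeral_2_eq_2)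
  also have "\<dots> = weight J * (w 2 (angle (J e)) / w 0 (angle (J e)))"
    using assms finite_E by (simp add: prod.distrib weight_def)
  finally show ?thesis
    unfolding deriv_deriv_spin_potential unfolding deriv_spin_potential
    using True by (simp add: power2_eq_square algebra_simps)
next
  case False
  have "(\<Prod>g\<in>E. w (marks e e' g) (angle (J g))) =
      (\<Prod>g\<in>E. w 0 (angle (J g)) * (if g = e then w 1 (angle (J g)) / w 0 (angle (J g)) else 1) *
        (if g = e' then w 1 (angle (J g)) / w 0 (angle (J g)) else 1))"
    using False w_0_pos by (intro prod.cong refl) (auto simp: marks_def less_imp_neq[symmetric])
  also have "\<dots> = weight J * (w 1 (angle (J e)) / w 0 (angle (J e))) * (w 1 (angle (J e')) / w 0 (angle (J e')))"
    using assms finite_E by (simp add: prod.distrib weight_def)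
  finally show ?thesis using False by (simp add: deriv_spin_potential)
qed

lemma weight_nonneg: "weight J \<ge> 0"
  unfolding weight_def using w_0_pos by (intro prod_nonneg) (auto intro: less_imp_le)

lemma height_weight_nonneg: "height_weight n \<ge> 0"
  unfolding height_weight_def using c_nonneg by (intro prod_nonneg) auto

lemma borel_measurable_weight: "weight \<in> borel_measurable \<mu>"
  unfolding weight_def[abs_def] by (intro borel_measurable_prod measurable_edge borel_measurable_w_angle)

lemma weight_bounded: "\<exists>B. \<forall>J. weight J \<le> B"
proof -
  have "weight J \<le> (\<Prod>e\<in>E. \<integral>m. norm (fc 0 m) \<partial>count_space UNIV)" for J
    unfolding weight_def using w_0_pos w_bounded[of 0]
    by (intro prod_mono) (auto intro: less_imp_le order_trans[OF abs_ge_self])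
  then show ?thesis by blast
qed

lemma integrable_weight_mult:
  assumes [measurable]: "f \<in> borel_measurable \<mu>" and f: "\<And>J. \<bar>f J\<bar> \<le> K"
  shows "integrable \<mu> (\<lambda>J. weight J * f J)"
proof -
  interpret prob_space \<mu> by (rule prob_space_haar)
  note [measurable] = borel_measurable_weight
  obtain B where B: "\<And>J. weight J \<le> B" using weight_bounded by blast
  have "\<bar>weight J * f J\<bar> \<le> B * K" for J
    unfolding abs_mult using B[of J] f[of J] weight_nonneg[of J] by (intro mult_mono) auto
  then show ?thesis by (intro integrable_const_bound[of _ "B * K"]) auto
qed

lemma integrable_weight_U1:
  assumes "e \<in> E" "e' \<in> E"
  shows "integrable \<mu> (\<lambda>J. weight J * (U1 (J e) * U1 (J e')))"
proof -
  obtain K where K: "\<And>z. \<bar>U1 z\<bar> \<le> K" using spin_derivs_bounded by blast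
  note [measurable] = measurable_edge[OF assms(1) borel_measurable_spin_derivs(1)]
    measurable_edge[OF assms(2) borel_measurable_spin_derivs(1)]
  show ?thesis
  proof (rule integrable_weight_mult)
    show "\<bar>U1 (J e) * U1 (J e')\<bar> \<le> K * K" for J
      unfolding abs_mult using K[of "J e"] K[of "J e'"] by (intro mult_mono) auto
  qed measurable
qed

lemma integrable_weight_U2:
  assumes "e \<in> E"
  shows "integrable \<mu> (\<lambda>J. weight J * U2 (J e))"
proof -
  obtain K where K: "\<And>z. \<bar>U2 z\<bar> \<le> K" using spin_derivs_bounded by blast
  show ?thesis
    by (rule integrable_weight_mult[OF measurable_edge[OF assms borel_measurable_spin_derivs(2)] K])
qed

text \<open>One integral, of the product of marked factors, is evaluated twice: by Fourier expansion
  it is minus the unnormalised height correlation, by \<open>prod_w_marks\<close> it is the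
  difference of the spin terms.\<close>

lemma two_point_duality:
  assumes e: "e \<in> E" "e' \<in> E"
  shows "(\<integral>n. real_of_int (n e) * real_of_int (n e') * height_weight n \<partial>count_space (H k G)) +
      (\<integral>J. weight J * (U1 (J e) * U1 (J e')) \<partial>\<mu>) =
    of_bool (e = e') * (\<integral>J. weight J * U2 (J e) \<partial>\<mu>)"
proof -
  have "complex_of_real (\<integral>J. (\<Prod>g\<in>E. w (marks e e' g) (angle (J g))) \<partial>\<mu>) =
      of_real (\<integral>n. - (n e * n e' * height_weight n) \<partial>count_space (H k G))"
    unfolding integral_prod_w[OF marks_le] prod_fc_marks[OF e] integral_complex_of_real ..
  then have "(\<integral>J. (\<Prod>g\<in>E. w (marks e e' g) (angle (J g))) \<partial>\<mu>) =
      - (\<integral>n. real_of_int (n e) * real_of_int (n e') * height_weight n \<partial>count_space (H k G))"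
    by (simp only: of_real_eq_iff) simp
  moreover have "(\<integral>J. (\<Prod>g\<in>E. w (marks e e' g) (angle (J g))) \<partial>\<mu>) =
      (\<integral>J. weight J * (U1 (J e) * U1 (J e')) \<partial>\<mu>) - of_bool (e = e') * (\<integral>J. weight J * U2 (J e) \<partial>\<mu>)"
    unfolding prod_w_marks[OF e] mult.assoc
    using integrable_weight_U1[OF e] integrable_weight_U2[OF e(1)]
    by (subst Bochner_Integration.integral_diff) auto
  ultimately show ?thesis by simp
qed

text \<open>Normalised by the spin partition function, so that height and spin expectations share a
  denominator.\<close>

lemma integral_height_measure:
  "(\<integral>n. f n \<partial>height_measure G E V k) =
    (\<integral>n. height_weight n * f n \<partial>count_space (H k G)) / (\<integral>J. weight J \<partial>\<mu>)" for f :: "_ \<Rightarrow> real"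
  unfolding height_measure_def integral_weight exp_neg_sum[OF finite_E] height_weight_def[symmetric]
  by (rule integral_prob_density) (auto intro: height_weight_nonneg)

lemma integral_spin_measure:
  assumes "f \<in> borel_measurable \<mu>"
  shows "(\<integral>J. f J \<partial>spin_measure G E V (opp k)) = (\<integral>J. weight J * f J \<partial>\<mu>) / (\<integral>J. weight J \<partial>\<mu>)"
  unfolding spin_measure_def w_0[symmetric] weight_def[symmetric]
  by (rule integral_prob_density) (auto intro: weight_nonneg borel_measurable_weight assms)

lemma covariance_duality:
  fixes \<epsilon> \<omega> :: "'v \<times> 'v \<Rightarrow> real"
  shows "(\<integral>n. form_inner E (\<lambda>e. real_of_int (n e)) \<epsilon> * form_inner E (\<lambda>e. real_of_int (n e)) \<omega>
            \<partial>height_measure G E V k)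
       + (\<integral>J. form_inner E (spin_force G V J) \<epsilon> * form_inner E (spin_force G V J) \<omega>
            \<partial>spin_measure G E V (opp k))
       = (\<Sum>e\<in>E. (\<integral>J. U2 (J e) \<partial>spin_measure G E V (opp k)) * \<epsilon> e * \<omega> e)"
proof -
  let ?C = "count_space (H k G) :: ('v \<times> 'v \<Rightarrow> int) measure"
  define Z where "Z = (\<integral>J. weight J \<partial>\<mu>)"
  define N where "N e e' = (\<integral>n. real_of_int (n e) * real_of_int (n e') * height_weight n \<partial>?C)" for e e'
  define A where "A e e' = (\<integral>J. weight J * (U1 (J e) * U1 (J e')) \<partial>\<mu>)" for e e'
  define B where "B e = (\<integral>J. weight J * U2 (J e) \<partial>\<mu>)" for e
  have inner_mult: "t * (form_inner E f \<epsilon> * form_inner E f \<omega>) = (\<Sum>e\<in>E. \<Sum>e'\<in>E. \<epsilon> e * \<omega> e' * (t * (f e * f e')))" for t f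
    unfolding form_inner_def sum_product unfolding sum_distrib_left by (intro sum.cong refl) (simp add: mult_ac)
  have force: "form_inner E (spin_force G V J) \<eta> = form_inner E (\<lambda>e. U1 (J e)) \<eta>" for J \<eta>
    unfolding form_inner_def spin_force_def using E_subset by (intro sum.cong) auto
  have "(\<integral>n. form_inner E (\<lambda>e. real_of_int (n e)) \<epsilon> * form_inner E (\<lambda>e. real_of_int (n e)) \<omega> \<partial>height_measure G E V k)
      = (\<integral>n. (\<Sum>e\<in>E. \<Sum>e'\<in>E. \<epsilon> e * \<omega> e' * (height_weight n * (real_of_int (n e) * real_of_int (n e')))) \<partial>?C) / Z"
    unfolding integral_height_measure inner_mult Z_def ..
  also have "\<dots> = (\<Sum>e\<in>E. \<Sum>e'\<in>E. \<epsilon> e * \<omega> e' * N e e') / Z"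
    using integrable_marks
    by (simp add: Bochner_Integration.integral_sum N_def mult.commute[of "height_weight _"])
  finally have height: "(\<integral>n. form_inner E (\<lambda>e. real_of_int (n e)) \<epsilon> * form_inner E (\<lambda>e. real_of_int (n e)) \<omega> \<partial>height_measure G E V k)
      = (\<Sum>e\<in>E. \<Sum>e'\<in>E. \<epsilon> e * \<omega> e' * N e e') / Z" .
  have meas: "(\<lambda>J. form_inner E (\<lambda>e. U1 (J e)) \<eta>) \<in> borel_measurable \<mu>" for \<eta>
    unfolding form_inner_def
    by (intro borel_measurable_sum borel_measurable_times measurable_edge borel_measurable_spin_derivs) auto
  have "(\<integral>J. form_inner E (spin_force G V J) \<epsilon> * form_inner E (spin_force G V J) \<omega> \<partial>spin_measure G E V (opp k))
      = (\<integral>J. (\<Sum>e\<in>E. \<Sum>e'\<in>E. \<epsilon> e * \<omega> e' * (weight J * (U1 (J e) * U1 (J e')))) \<partial>\<mu>) / Z"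
    unfolding force by (subst integral_spin_measure) (auto intro!: borel_measurable_times meas simp: inner_mult Z_def)
  also have "\<dots> = (\<Sum>e\<in>E. \<Sum>e'\<in>E. \<epsilon> e * \<omega> e' * A e e') / Z"
    using integrable_weight_U1 by (simp add: Bochner_Integration.integral_sum A_def)
  finally have spin: "(\<integral>J. form_inner E (spin_force G V J) \<epsilon> * form_inner E (spin_force G V J) \<omega> \<partial>spin_measure G E V (opp k))
      = (\<Sum>e\<in>E. \<Sum>e'\<in>E. \<epsilon> e * \<omega> e' * A e e') / Z" .
  have "(\<Sum>e\<in>E. \<Sum>e'\<in>E. \<epsilon> e * \<omega> e' * N e e') + (\<Sum>e\<in>E. \<Sum>e'\<in>E. \<epsilon> e * \<omega> e' * A e e') =
      (\<Sum>e\<in>E. \<Sum>e'\<in>E. \<epsilon> e * \<omega> e' * (N e e' + A e e'))"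
    by (simp add: sum.distrib distrib_left)
  \<comment> \<open>Off the diagonal the height and spin correlations cancel; the diagonal leaves
    the second derivative of the spin potential.\<close>
  also have "\<dots> = (\<Sum>e\<in>E. \<Sum>e'\<in>E. if e = e' then B e * \<epsilon> e * \<omega> e else 0)"
    using two_point_duality by (intro sum.cong refl) (auto simp: N_def A_def B_def)
  also have "\<dots> = (\<Sum>e\<in>E. B e * \<epsilon> e * \<omega> e)"
    using finite_E by simp
  finally have sum: "(\<Sum>e\<in>E. \<Sum>e'\<in>E. \<epsilon> e * \<omega> e' * N e e') + (\<Sum>e\<in>E. \<Sum>e'\<in>E. \<epsilon> e * \<omega> e' * A e e') =
      (\<Sum>e\<in>E. B e * \<epsilon> e * \<omega> e)" .
  have "(\<integral>J. U2 (J e) \<partial>spin_measure G E V (opp k)) = B e / Z" if "e \<in> E" for e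
    unfolding B_def Z_def
    by (rule integral_spin_measure[OF measurable_edge[OF that borel_measurable_spin_derivs(2)]])
  then have "(\<Sum>e\<in>E. (\<integral>J. U2 (J e) \<partial>spin_measure G E V (opp k)) * \<epsilon> e * \<omega> e) = (\<Sum>e\<in>E. B e * \<epsilon> e * \<omega> e) / Z"
    by (simp add: sum_divide_distrib)
  then show ?thesis unfolding height spin sum[symmetric] by (simp add: add_divide_distrib)
qed

end

theorem lemma2p2:
  fixes G :: "'v pair_pre_digraph" and E :: "('v \<times> 'v) set"
    and V :: "int \<Rightarrow> ereal" and k :: kind
    and \<epsilon> \<omega> :: "'v \<times> 'v \<Rightarrow> real"
  assumes "pair_graph G" and "orientation G E"
    and "height_potential V"
    and "\<epsilon> \<in> one_forms G" and "\<omega> \<in> one_forms G"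
  shows "(\<integral>n. form_inner E (\<lambda>e. real_of_int (n e)) \<epsilon> * form_inner E (\<lambda>e. real_of_int (n e)) \<omega>
            \<partial>height_measure G E V k)
       + (\<integral>J. form_inner E (spin_force G V J) \<epsilon> * form_inner E (spin_force G V J) \<omega>
            \<partial>spin_measure G E V (opp k))
       = (\<Sum>e\<in>E. (\<integral>J. deriv (deriv (spin_potential V)) (angle (J e)) \<partial>spin_measure G E V (opp k))
            * \<epsilon> e * \<omega> e)"
  by (intro spin_height_duality.covariance_duality spin_height_duality.intro
      oriented_graph.intro height_pot.intro assms)

end
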